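(* Let $\mathbb G$ be an affine group scheme of finite type over $k$ and let $\{X_i\}_{i\ge 0}$ be an ascending converging sequence of subspaces of $\mathcal O(\mathbb G)$. If $M$ is a finite dimensional $\mathbb G$-module, then $M$ is an $X_i$-comodule for all $i \gg 0$. Moreover, sending an arbitrary $\mathbb G$-module $M$ to the sequence of $\mathbb G$-submodules $$M_{X_0} \subset M_{X_1} \subset M_{X_2} \subset \cdots \subset \bigcup_{i \geq 0} M_{X_i} = M$$ is a filtration of $M$, functorial in $M$, with the property that each $M_{X_i}$ is an $X_i$-comodule.
   Context: $k$ is a field of characteristic $p>0$. $\mathcal O(\mathbb G)$ is the coordinate algebra of $\mathbb G$. A $\mathbb G$-module is a (possibly infinite dimensional) right $\mathcal O(\mathbb G)$-comodule $M$ over $k$ with coaction $\Delta_M: M \to M\otimes \mathcal O(\mathbb G)$. For a $k$-subspace $X \subset \mathcal O(\mathbb G)$, an $X$-comodule is a $\mathbb G$-module $M$ whose coaction $\Delta_M$ factors through $M\otimes X \subset M \otimes \mathcal O(\mathbb G)$. For a $\mathbb G$-module $M$, $M_X \subset M$ denotes the union of all $\mathbb G$-submodules of $M$ which are $X$-comodules. An ascending converging sequence of subspaces of $\mathcal O(\mathbb G)$ is a sequence of $k$-subspaces $\{X_i\}_{i\geq 0}$ with $X_i \subset X_{i+1}$ for all $i \ge 0$ and $\bigcup_{i\geq 0} X_i = \mathcal O(\mathbb G)$. *)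

theory Defs
  imports
    "HOL-Algebra.Generated_Rings"
    "Jordan_Normal_Form.Missing_VectorSpace"
begin

hide_const (open) Multiset.mult  \<comment> \<open>shadows the record field\<close>

section \<open>Tensor products of modules\<close>

text \<open>
  The tensor product is the usual quotient of the free module on \<open>carrier M \<times> carrier N\<close> by the
  bilinearity relations.  The record fields \<open>mult\<close> and \<open>one\<close> carry no information for objects
  that are only modules.
\<close>

definition free_module :: "('k, 'c) ring_scheme \<Rightarrow> 'b set \<Rightarrow> ('k, 'b \<Rightarrow> 'k) module" where
  "free_module K B =
    \<lparr>carrier = {f. range f \<subseteq> carrier K \<and> finite {b. f b \<noteq> \<zero>\<^bsub>K\<^esub>} \<and> {b. f b \<noteq> \<zero>\<^bsub>K\<^esub>} \<subseteq> B},
     mult = (\<lambda>f g b. \<zero>\<^bsub>K\<^esub>), one = (\<lambda>b. \<zero>\<^bsub>K\<^esub>),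
     zero = (\<lambda>b. \<zero>\<^bsub>K\<^esub>), add = (\<lambda>f g b. f b \<oplus>\<^bsub>K\<^esub> g b),
     smult = (\<lambda>c f b. c \<otimes>\<^bsub>K\<^esub> f b)\<rparr>"

definition free_gen :: "('k, 'c) ring_scheme \<Rightarrow> 'b \<Rightarrow> 'b \<Rightarrow> 'k" where
  "free_gen K b = (\<lambda>x. if x = b then \<one>\<^bsub>K\<^esub> else \<zero>\<^bsub>K\<^esub>)"

definition quotient_module ::
    "('k, 'v, 'd) module_scheme \<Rightarrow> 'v set \<Rightarrow> ('k, 'v set) module" where
  "quotient_module V W =
    \<lparr>carrier = a_rcosets\<^bsub>V\<^esub> W,
     mult = (\<lambda>C D. W), one = W,
     zero = W, add = set_add V,
     smult = (\<lambda>c C. \<Union>v\<in>C. W +>\<^bsub>V\<^esub> (c \<odot>\<^bsub>V\<^esub> v))\<rparr>"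

definition tensor_relations ::
    "('k, 'c) ring_scheme \<Rightarrow> ('k, 'm, 'd) module_scheme \<Rightarrow> ('k, 'n, 'e) module_scheme
      \<Rightarrow> ('m \<times> 'n \<Rightarrow> 'k) set" where
  "tensor_relations K M N = (let F = free_module K (carrier M \<times> carrier N); g = free_gen K in
      {g (m \<oplus>\<^bsub>M\<^esub> m', n) \<ominus>\<^bsub>F\<^esub> (g (m, n) \<oplus>\<^bsub>F\<^esub> g (m', n)) | m m' n.
         m \<in> carrier M \<and> m' \<in> carrier M \<and> n \<in> carrier N}
    \<union> {g (m, n \<oplus>\<^bsub>N\<^esub> n') \<ominus>\<^bsub>F\<^esub> (g (m, n) \<oplus>\<^bsub>F\<^esub> g (m, n')) | m n n'.
         m \<in> carrier M \<and> n \<in> carrier N \<and> n' \<in> carrier N}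
    \<union> {g (c \<odot>\<^bsub>M\<^esub> m, n) \<ominus>\<^bsub>F\<^esub> c \<odot>\<^bsub>F\<^esub> g (m, n) | c m n.
         c \<in> carrier K \<and> m \<in> carrier M \<and> n \<in> carrier N}
    \<union> {g (m, c \<odot>\<^bsub>N\<^esub> n) \<ominus>\<^bsub>F\<^esub> c \<odot>\<^bsub>F\<^esub> g (m, n) | c m n.
         c \<in> carrier K \<and> m \<in> carrier M \<and> n \<in> carrier N})"

definition tensor_rel_space ::
    "('k, 'c) ring_scheme \<Rightarrow> ('k, 'm, 'd) module_scheme \<Rightarrow> ('k, 'n, 'e) module_scheme
      \<Rightarrow> ('m \<times> 'n \<Rightarrow> 'k) set" where
  "tensor_rel_space K M N =
    module.span K (free_module K (carrier M \<times> carrier N)) (tensor_relations K M N)"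

definition tensor ::
    "('k, 'c) ring_scheme \<Rightarrow> ('k, 'm, 'd) module_scheme \<Rightarrow> ('k, 'n, 'e) module_scheme
      \<Rightarrow> ('k, ('m \<times> 'n \<Rightarrow> 'k) set) module" where
  "tensor K M N =
    quotient_module (free_module K (carrier M \<times> carrier N)) (tensor_rel_space K M N)"

definition pure_tensor ::
    "('k, 'c) ring_scheme \<Rightarrow> ('k, 'm, 'd) module_scheme \<Rightarrow> ('k, 'n, 'e) module_scheme
      \<Rightarrow> 'm \<Rightarrow> 'n \<Rightarrow> ('m \<times> 'n \<Rightarrow> 'k) set" where
  "pure_tensor K M N m n =
    tensor_rel_space K M N +>\<^bsub>free_module K (carrier M \<times> carrier N)\<^esub> free_gen K (m, n)"

text \<open>
  For a bilinear \<open>\<beta> : M \<times> N \<rightarrow> P\<close>, \<open>tensor_lift K P \<beta>\<close> is the linear map \<open>M \<otimes> N \<rightarrow> P\<close> with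
  \<open>m \<otimes> n \<mapsto> \<beta> m n\<close>, computed on a representative of the coset (see \<open>tensor_lift_pure\<close> and
  \<open>tensor_lift_hom\<close> below).
\<close>

definition tensor_lift ::
    "('k, 'c) ring_scheme \<Rightarrow> ('k, 'p, 'd) module_scheme \<Rightarrow> ('m \<Rightarrow> 'n \<Rightarrow> 'p)
      \<Rightarrow> ('m \<times> 'n \<Rightarrow> 'k) set \<Rightarrow> 'p" where
  "tensor_lift K P \<beta> C = (let h = (SOME h. h \<in> C) in
     \<Oplus>\<^bsub>P\<^esub>q\<in>{q. h q \<noteq> \<zero>\<^bsub>K\<^esub>}. h q \<odot>\<^bsub>P\<^esub> \<beta> (fst q) (snd q))"

subsection \<open>Universal property\<close>

lemma free_module_module:
  fixes K :: "('k, 'c) ring_scheme"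
  assumes "cring K"
  shows "module K (free_module K B)"
proof -
  interpret K: cring K by fact
  have sub: "{b. f b \<oplus>\<^bsub>K\<^esub> g b \<noteq> \<zero>\<^bsub>K\<^esub>} \<subseteq> {b. f b \<noteq> \<zero>\<^bsub>K\<^esub>} \<union> {b. g b \<noteq> \<zero>\<^bsub>K\<^esub>}" for f g :: "'b \<Rightarrow> 'k"
    by auto
  have add: "f \<oplus>\<^bsub>free_module K B\<^esub> g \<in> carrier (free_module K B)"
    if "f \<in> carrier (free_module K B)" "g \<in> carrier (free_module K B)" for f g
    using that sub[of f g] unfolding free_module_def
    by (auto simp: image_subset_iff intro: finite_subset[OF sub])
  have smult: "c \<odot>\<^bsub>free_module K B\<^esub> f \<in> carrier (free_module K B)"
    if "f \<in> carrier (free_module K B)" "c \<in> carrier K" for f c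
  proof -
    have "{b. c \<otimes>\<^bsub>K\<^esub> f b \<noteq> \<zero>\<^bsub>K\<^esub>} \<subseteq> {b. f b \<noteq> \<zero>\<^bsub>K\<^esub>}" using that by auto
    with that show ?thesis unfolding free_module_def
      by (auto simp: image_subset_iff intro: finite_subset)
  qed
  have neg: "\<exists>g\<in>carrier (free_module K B). g \<oplus>\<^bsub>free_module K B\<^esub> f = \<zero>\<^bsub>free_module K B\<^esub>"
    if f: "f \<in> carrier (free_module K B)" for f
    by (rule bexI[OF _ smult[OF f, of "\<ominus>\<^bsub>K\<^esub> \<one>\<^bsub>K\<^esub>"]])
       (use f in \<open>auto simp: free_module_def image_subset_iff K.l_minus K.l_neg\<close>)
  have ab: "abelian_group (free_module K B)"
    by (rule abelian_groupI, fact add, simp_all add: neg,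
        auto simp: free_module_def image_subset_iff fun_eq_iff K.a_ac)
  show ?thesis
    by (rule moduleI[OF assms ab], fact smult[rotated],
        auto simp: free_module_def image_subset_iff fun_eq_iff K.l_distr K.r_distr K.m_assoc)
qed

lemma submodule_abelian_subgroup:
  assumes "module K V" "submodule K W V"
  shows "abelian_subgroup W V"
proof -
  interpret module K V by fact
  interpret W: submodule K W V by fact
  have W: "w \<in> carrier V" if "w \<in> W" for w using W.subset that by blast
  have inv: "\<ominus>\<^bsub>V\<^esub> w \<in> W" if "w \<in> W" for w
    using W.smult_closed[of "\<ominus>\<^bsub>K\<^esub> \<one>\<^bsub>K\<^esub>" w] that W[OF that] smult_l_minus[of "\<one>\<^bsub>K\<^esub>" w] by auto
  have "additive_subgroup W V"
    by (rule additive_subgroup.intro, rule subgroup.intro)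
       (use W inv in \<open>auto simp: a_inv_def[symmetric]\<close>)
  then show ?thesis
    by (rule abelian_subgroupI3) (rule M.abelian_group_axioms)
qed

lemma quotient_module_smult:
  assumes "module K V" "submodule K W V" "c \<in> carrier K" "v \<in> carrier V"
  shows "c \<odot>\<^bsub>quotient_module V W\<^esub> (W +>\<^bsub>V\<^esub> v) = W +>\<^bsub>V\<^esub> (c \<odot>\<^bsub>V\<^esub> v)"
proof -
  interpret module K V by fact
  interpret W: submodule K W V by fact
  interpret abelian_subgroup W V by (rule submodule_abelian_subgroup) fact+
  have "W +>\<^bsub>V\<^esub> (c \<odot>\<^bsub>V\<^esub> u) = W +>\<^bsub>V\<^esub> (c \<odot>\<^bsub>V\<^esub> v)" if "u \<in> W +>\<^bsub>V\<^esub> v" for u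
  proof -
    have u: "u \<in> carrier V" using that assms(4) by (rule a_elemrcos_carrier[rotated])
    have "u \<oplus>\<^bsub>V\<^esub> \<ominus>\<^bsub>V\<^esub> v \<in> W" using that assms(4) by (rule a_rcos_module_imp[rotated])
    then have "c \<odot>\<^bsub>V\<^esub> u \<oplus>\<^bsub>V\<^esub> \<ominus>\<^bsub>V\<^esub> (c \<odot>\<^bsub>V\<^esub> v) \<in> W"
      using W.smult_closed[OF assms(3), of "u \<oplus>\<^bsub>V\<^esub> \<ominus>\<^bsub>V\<^esub> v"] u assms
      by (simp add: smult_r_distr smult_r_minus)
    then have "c \<odot>\<^bsub>V\<^esub> u \<in> W +>\<^bsub>V\<^esub> (c \<odot>\<^bsub>V\<^esub> v)"
      using u assms by (intro a_rcos_module_rev) auto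
    then show ?thesis using assms by (intro a_repr_independence'[symmetric]) auto
  qed
  moreover have "v \<in> W +>\<^bsub>V\<^esub> v" using assms(4) by (rule a_rcos_self)
  ultimately have "(\<Union>u\<in>W +>\<^bsub>V\<^esub> v. W +>\<^bsub>V\<^esub> (c \<odot>\<^bsub>V\<^esub> u)) = W +>\<^bsub>V\<^esub> (c \<odot>\<^bsub>V\<^esub> v)" by blast
  then show ?thesis by (simp only: quotient_module_def module.simps)
qed

lemma quotient_module_carrier:
  "carrier (quotient_module V W) = (\<lambda>v. W +>\<^bsub>V\<^esub> v) ` carrier V"
  by (auto simp: quotient_module_def A_RCOSETS_def RCOSETS_def a_r_coset_def)

lemma quotient_module_module:
  assumes "module K V" "submodule K W V"
  shows "module K (quotient_module V W)"
proof -
  interpret module K V by fact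
  interpret W: submodule K W V by fact
  interpret abelian_subgroup W V by (rule submodule_abelian_subgroup) fact+
  let ?Q = "quotient_module V W"
  have add: "(W +>\<^bsub>V\<^esub> u) \<oplus>\<^bsub>?Q\<^esub> (W +>\<^bsub>V\<^esub> v) = W +>\<^bsub>V\<^esub> (u \<oplus>\<^bsub>V\<^esub> v)"
    if "u \<in> carrier V" "v \<in> carrier V" for u v
    using a_rcos_sum[OF that] by (simp add: quotient_module_def)
  have zero: "\<zero>\<^bsub>?Q\<^esub> = W +>\<^bsub>V\<^esub> \<zero>\<^bsub>V\<^esub>"
    using a_rcos_const[of "\<zero>\<^bsub>V\<^esub>"] by (simp add: quotient_module_def)
  note smult = quotient_module_smult[OF assms]
  have E: thesis if "C \<in> carrier ?Q" "\<And>v. v \<in> carrier V \<Longrightarrow> C = W +>\<^bsub>V\<^esub> v \<Longrightarrow> thesis" for C thesis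
    using that(1) unfolding quotient_module_carrier by (rule imageE) (rule that(2))
  have I: "W +>\<^bsub>V\<^esub> v \<in> carrier ?Q" if "v \<in> carrier V" for v
    using that unfolding quotient_module_carrier by (rule imageI)
  have ab: "abelian_group ?Q"
  proof (rule abelian_groupI)
    show "\<zero>\<^bsub>?Q\<^esub> \<in> carrier ?Q" unfolding zero by (rule I) simp
  next
    fix C D assume "C \<in> carrier ?Q" "D \<in> carrier ?Q"
    then obtain u v where uv: "u \<in> carrier V" "C = W +>\<^bsub>V\<^esub> u" "v \<in> carrier V" "D = W +>\<^bsub>V\<^esub> v"
      by (elim E)
    show "C \<oplus>\<^bsub>?Q\<^esub> D \<in> carrier ?Q" using uv by (simp only: add I M.a_closed)
    show "C \<oplus>\<^bsub>?Q\<^esub> D = D \<oplus>\<^bsub>?Q\<^esub> C" using uv M.a_comm[of u v] by (simp only: add)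
    fix B assume "B \<in> carrier ?Q"
    then obtain x where x: "x \<in> carrier V" "B = W +>\<^bsub>V\<^esub> x" by (rule E)
    show "C \<oplus>\<^bsub>?Q\<^esub> D \<oplus>\<^bsub>?Q\<^esub> B = C \<oplus>\<^bsub>?Q\<^esub> (D \<oplus>\<^bsub>?Q\<^esub> B)"
      using uv x by (simp only: add M.a_closed M.a_assoc)
  next
    fix C assume "C \<in> carrier ?Q"
    then obtain u where u: "u \<in> carrier V" "C = W +>\<^bsub>V\<^esub> u" by (rule E)
    show "\<zero>\<^bsub>?Q\<^esub> \<oplus>\<^bsub>?Q\<^esub> C = C" using u by (simp only: zero add M.zero_closed M.l_zero)
    show "\<exists>D\<in>carrier ?Q. D \<oplus>\<^bsub>?Q\<^esub> C = \<zero>\<^bsub>?Q\<^esub>"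
      by (rule bexI[OF _ I[of "\<ominus>\<^bsub>V\<^esub> u"]])
         (use u in \<open>simp_all only: zero add M.a_inv_closed M.l_neg\<close>)
  qed
  show ?thesis
  proof (rule moduleI[OF R.is_cring ab])
    fix c C assume c: "c \<in> carrier K" and "C \<in> carrier ?Q"
    then obtain u where u: "u \<in> carrier V" "C = W +>\<^bsub>V\<^esub> u" by (elim E)
    show "c \<odot>\<^bsub>?Q\<^esub> C \<in> carrier ?Q" using c u by (simp only: smult I smult_closed)
    {
      fix d assume d: "d \<in> carrier K"
      show "(c \<oplus>\<^bsub>K\<^esub> d) \<odot>\<^bsub>?Q\<^esub> C = c \<odot>\<^bsub>?Q\<^esub> C \<oplus>\<^bsub>?Q\<^esub> d \<odot>\<^bsub>?Q\<^esub> C"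
        using c d u by (simp only: smult add smult_closed smult_l_distr R.a_closed)
      show "(c \<otimes>\<^bsub>K\<^esub> d) \<odot>\<^bsub>?Q\<^esub> C = c \<odot>\<^bsub>?Q\<^esub> (d \<odot>\<^bsub>?Q\<^esub> C)"
        using c d u by (simp only: smult smult_closed smult_assoc1 R.m_closed)
    next
      fix D assume "D \<in> carrier ?Q"
      then obtain v where v: "v \<in> carrier V" "D = W +>\<^bsub>V\<^esub> v" by (rule E)
      show "c \<odot>\<^bsub>?Q\<^esub> (C \<oplus>\<^bsub>?Q\<^esub> D) = c \<odot>\<^bsub>?Q\<^esub> C \<oplus>\<^bsub>?Q\<^esub> c \<odot>\<^bsub>?Q\<^esub> D"
        using c u v by (simp only: smult add smult_closed smult_r_distr M.a_closed)
    }
  next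
    fix C assume "C \<in> carrier ?Q"
    then obtain u where u: "u \<in> carrier V" "C = W +>\<^bsub>V\<^esub> u" by (rule E)
    show "\<one>\<^bsub>K\<^esub> \<odot>\<^bsub>?Q\<^esub> C = C" using u by (simp only: smult R.one_closed smult_one)
  qed
qed

lemma free_gen_carrier:
  assumes "cring K" "b \<in> B"
  shows "free_gen K b \<in> carrier (free_module K B)"
proof -
  interpret K: cring K by fact
  have sub: "{x. free_gen K b x \<noteq> \<zero>\<^bsub>K\<^esub>} \<subseteq> {b}"
    unfolding free_gen_def by (rule subsetI) (simp split: if_splits)
  then have fin: "finite {x. free_gen K b x \<noteq> \<zero>\<^bsub>K\<^esub>}" by (rule finite_subset) simp
  have ran: "range (free_gen K b) \<subseteq> carrier K"
    unfolding free_gen_def by (rule subsetI) (elim imageE, simp split: if_splits)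
  have subB: "{x. free_gen K b x \<noteq> \<zero>\<^bsub>K\<^esub>} \<subseteq> B" using sub assms(2) by blast
  show ?thesis unfolding free_module_def partial_object.simps mem_Collect_eq
    by (intro conjI ran fin subB)
qed

lemma tensor_relations_carrier:
  assumes "module K M" "module K N"
  shows "tensor_relations K M N \<subseteq> carrier (free_module K (carrier M \<times> carrier N))"
proof -
  interpret M: module K M by fact
  interpret N: module K N by fact
  interpret F: module K "free_module K (carrier M \<times> carrier N)"
    by (rule free_module_module) (rule M.R.is_cring)
  have gc: "free_gen K (m, n) \<in> carrier (free_module K (carrier M \<times> carrier N))"
    if "m \<in> carrier M" "n \<in> carrier N" for m n
    using that by (intro free_gen_carrier M.R.is_cring) auto
  show ?thesis unfolding tensor_relations_def Let_def
    apply (rule subsetI)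
    apply (elim UnE CollectE exE conjE; hypsubst)
       apply (intro F.M.minus_closed F.M.a_closed F.smult_closed gc M.M.a_closed N.M.a_closed
         M.smult_closed N.smult_closed; assumption)+
    done
qed

lemma tensor_rel_submodule:
  assumes "module K M" "module K N"
  shows "submodule K (tensor_rel_space K M N) (free_module K (carrier M \<times> carrier N))"
proof -
  interpret M: module K M by fact
  interpret F: module K "free_module K (carrier M \<times> carrier N)"
    by (rule free_module_module) (rule M.R.is_cring)
  show ?thesis unfolding tensor_rel_space_def
    by (rule F.span_is_submodule) (rule tensor_relations_carrier[OF assms])
qed

lemma tensor_module:
  assumes "module K M" "module K N"
  shows "module K (tensor K M N)"
  unfolding tensor_def
  by (rule quotient_module_module[OF free_module_module[OF module.axioms(1)[OF assms(1)]]
        tensor_rel_submodule[OF assms]])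

definition bilinear_map ::
    "('k, 'c) ring_scheme \<Rightarrow> ('k, 'm, 'd) module_scheme \<Rightarrow> ('k, 'n, 'e) module_scheme
      \<Rightarrow> ('k, 'p, 'f) module_scheme \<Rightarrow> ('m \<Rightarrow> 'n \<Rightarrow> 'p) \<Rightarrow> bool" where
  "bilinear_map K M N P \<beta> \<longleftrightarrow>
    (\<forall>m\<in>carrier M. (\<lambda>n. \<beta> m n) \<in> module_hom K N P) \<and>
    (\<forall>n\<in>carrier N. (\<lambda>m. \<beta> m n) \<in> module_hom K M P)"

context
  fixes K :: "('k, 'c) ring_scheme" and M :: "('k, 'm, 'd) module_scheme"
    and N :: "('k, 'n, 'e) module_scheme" and P :: "('k, 'p, 'f) module_scheme"
    and \<beta> :: "'m \<Rightarrow> 'n \<Rightarrow> 'p"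
  assumes mods: "module K M" "module K N" "module K P"
    and bil: "bilinear_map K M N P \<beta>"
begin

private abbreviation "F \<equiv> free_module K (carrier M \<times> carrier N)"
private abbreviation "ev h \<equiv> \<Oplus>\<^bsub>P\<^esub>q\<in>{q. h q \<noteq> \<zero>\<^bsub>K\<^esub>}. h q \<odot>\<^bsub>P\<^esub> \<beta> (fst q) (snd q)"

interpretation M: module K M by (fact mods)
interpretation N: module K N by (fact mods)
interpretation P: module K P by (fact mods)
interpretation F: module K "free_module K (carrier M \<times> carrier N)"
  by (rule free_module_module) (rule M.R.is_cring)

private lemma bil_closed: "m \<in> carrier M \<Longrightarrow> n \<in> carrier N \<Longrightarrow> \<beta> m n \<in> carrier P"
proof -
  assume m: "m \<in> carrier M" and n: "n \<in> carrier N"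
  from bil m have "(\<lambda>n. \<beta> m n) \<in> module_hom K N P" unfolding bilinear_map_def by blast
  from module_hom_closed[OF this] n show ?thesis by (rule funcset_mem)
qed

private lemma term_closed: "c \<in> carrier K \<Longrightarrow> q \<in> carrier M \<times> carrier N \<Longrightarrow>
    c \<odot>\<^bsub>P\<^esub> \<beta> (fst q) (snd q) \<in> carrier P"
  by (intro P.smult_closed bil_closed) (simp_all add: mem_Times_iff)

private lemma hK: "h \<in> carrier F \<Longrightarrow> h q \<in> carrier K"
  by (cases q) (simp add: free_module_def image_subset_iff)

private lemma ev_extend:
  assumes "h \<in> carrier F" "finite D" "{q. h q \<noteq> \<zero>\<^bsub>K\<^esub>} \<subseteq> D" "D \<subseteq> carrier M \<times> carrier N"
  shows "ev h = (\<Oplus>\<^bsub>P\<^esub>q\<in>D. h q \<odot>\<^bsub>P\<^esub> \<beta> (fst q) (snd q))"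
proof (rule P.M.add.finprod_mono_neutral_cong_left)
  show "h i \<odot>\<^bsub>P\<^esub> \<beta> (fst i) (snd i) = \<zero>\<^bsub>P\<^esub>" if "i \<in> D - {q. h q \<noteq> \<zero>\<^bsub>K\<^esub>}" for i
  proof -
    have "h i = \<zero>\<^bsub>K\<^esub>" "i \<in> carrier M \<times> carrier N" using that assms(4) by blast+
    then show ?thesis by (simp add: bil_closed mem_Times_iff)
  qed
  show "(\<lambda>q. h q \<odot>\<^bsub>P\<^esub> \<beta> (fst q) (snd q)) \<in> D \<rightarrow> carrier P"
    using assms(4) by (intro funcsetI term_closed hK assms(1)) blast
qed (use assms in simp_all)

private lemma ev_hom: "ev \<in> module_hom K F P"
proof -
  have fin: "finite {q. h q \<noteq> \<zero>\<^bsub>K\<^esub>}" if "h \<in> carrier F" for h using that by (simp add: free_module_def)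
  have sub: "{q. h q \<noteq> \<zero>\<^bsub>K\<^esub>} \<subseteq> carrier M \<times> carrier N" if "h \<in> carrier F" for h
    using that by (simp add: free_module_def)
  have closed: "ev h \<in> carrier P" if "h \<in> carrier F" for h
    using sub[OF that] by (intro P.M.finsum_closed funcsetI term_closed hK that) blast
  have add: "ev (g \<oplus>\<^bsub>F\<^esub> h) = ev g \<oplus>\<^bsub>P\<^esub> ev h" if gh: "g \<in> carrier F" "h \<in> carrier F" for g h
  proof -
    let ?D = "{q. g q \<noteq> \<zero>\<^bsub>K\<^esub>} \<union> {q. h q \<noteq> \<zero>\<^bsub>K\<^esub>}"
    have D: "finite ?D" "?D \<subseteq> carrier M \<times> carrier N" using fin[OF gh(1)] fin[OF gh(2)] sub[OF gh(1)] sub[OF gh(2)] by blast+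
    have val: "(g \<oplus>\<^bsub>F\<^esub> h) q = g q \<oplus>\<^bsub>K\<^esub> h q" for q by (simp add: free_module_def)
    have "ev (g \<oplus>\<^bsub>F\<^esub> h) = (\<Oplus>\<^bsub>P\<^esub>q\<in>?D. (g \<oplus>\<^bsub>F\<^esub> h) q \<odot>\<^bsub>P\<^esub> \<beta> (fst q) (snd q))"
      using D by (intro ev_extend F.M.a_closed[OF gh]) (auto simp: val)
    also have "\<dots> = (\<Oplus>\<^bsub>P\<^esub>q\<in>?D. g q \<odot>\<^bsub>P\<^esub> \<beta> (fst q) (snd q) \<oplus>\<^bsub>P\<^esub> h q \<odot>\<^bsub>P\<^esub> \<beta> (fst q) (snd q))"
      unfolding val
    proof (rule P.M.finsum_cong'[OF refl])
      fix q assume "q \<in> ?D"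
      then have "q \<in> carrier M \<times> carrier N" using D by blast
      then show "(g q \<oplus>\<^bsub>K\<^esub> h q) \<odot>\<^bsub>P\<^esub> \<beta> (fst q) (snd q)
          = g q \<odot>\<^bsub>P\<^esub> \<beta> (fst q) (snd q) \<oplus>\<^bsub>P\<^esub> h q \<odot>\<^bsub>P\<^esub> \<beta> (fst q) (snd q)"
        by (intro P.smult_l_distr bil_closed hK gh) (simp_all add: mem_Times_iff)
    next
      show "(\<lambda>q. g q \<odot>\<^bsub>P\<^esub> \<beta> (fst q) (snd q) \<oplus>\<^bsub>P\<^esub> h q \<odot>\<^bsub>P\<^esub> \<beta> (fst q) (snd q)) \<in> ?D \<rightarrow> carrier P"
        using D by (intro funcsetI P.M.a_closed term_closed hK gh) blast+
    qed
    also have "\<dots> = (\<Oplus>\<^bsub>P\<^esub>q\<in>?D. g q \<odot>\<^bsub>P\<^esub> \<beta> (fst q) (snd q)) \<oplus>\<^bsub>P\<^esub> (\<Oplus>\<^bsub>P\<^esub>q\<in>?D. h q \<odot>\<^bsub>P\<^esub> \<beta> (fst q) (snd q))"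
      using D by (intro P.M.finsum_addf funcsetI term_closed hK gh) blast+
    also have "\<dots> = ev g \<oplus>\<^bsub>P\<^esub> ev h"
      using ev_extend[OF gh(1) D(1) _ D(2)] ev_extend[OF gh(2) D(1) _ D(2)] by simp
    finally show ?thesis .
  qed
  have smult: "ev (c \<odot>\<^bsub>F\<^esub> h) = c \<odot>\<^bsub>P\<^esub> ev h" if ch: "c \<in> carrier K" "h \<in> carrier F" for c h
  proof -
    let ?D = "{q. h q \<noteq> \<zero>\<^bsub>K\<^esub>}"
    note D = fin[OF ch(2)] sub[OF ch(2)]
    have val: "(c \<odot>\<^bsub>F\<^esub> h) q = c \<otimes>\<^bsub>K\<^esub> h q" for q by (simp add: free_module_def)
    have "ev (c \<odot>\<^bsub>F\<^esub> h) = (\<Oplus>\<^bsub>P\<^esub>q\<in>?D. (c \<odot>\<^bsub>F\<^esub> h) q \<odot>\<^bsub>P\<^esub> \<beta> (fst q) (snd q))"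
      using D ch(1) by (intro ev_extend F.smult_closed[OF ch]) (auto simp: val)
    also have "\<dots> = (\<Oplus>\<^bsub>P\<^esub>q\<in>?D. c \<odot>\<^bsub>P\<^esub> (h q \<odot>\<^bsub>P\<^esub> \<beta> (fst q) (snd q)))"
      unfolding val
    proof (rule P.M.finsum_cong'[OF refl])
      fix q assume "q \<in> ?D"
      then have "q \<in> carrier M \<times> carrier N" using D by blast
      then show "(c \<otimes>\<^bsub>K\<^esub> h q) \<odot>\<^bsub>P\<^esub> \<beta> (fst q) (snd q)
          = c \<odot>\<^bsub>P\<^esub> (h q \<odot>\<^bsub>P\<^esub> \<beta> (fst q) (snd q))"
        by (intro P.smult_assoc1 bil_closed hK ch) (simp_all add: mem_Times_iff)
    next
      show "(\<lambda>q. c \<odot>\<^bsub>P\<^esub> (h q \<odot>\<^bsub>P\<^esub> \<beta> (fst q) (snd q))) \<in> ?D \<rightarrow> carrier P"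
        using D by (intro funcsetI P.smult_closed[OF ch(1)] term_closed hK ch) blast
    qed
    also have "\<dots> = c \<odot>\<^bsub>P\<^esub> ev h"
      using D ch(1) by (intro P.finsum_smult_ldistr[symmetric] funcsetI term_closed hK ch) blast+
    finally show ?thesis .
  qed
  show ?thesis unfolding module_hom_def mem_Collect_eq using closed add smult by blast
qed

private lemma ev_gen: "ev (free_gen K (m, n)) = \<beta> m n" if "m \<in> carrier M" "n \<in> carrier N"
proof -
  have "ev (free_gen K (m, n)) = (\<Oplus>\<^bsub>P\<^esub>q\<in>{(m, n)}. free_gen K (m, n) q \<odot>\<^bsub>P\<^esub> \<beta> (fst q) (snd q))"
    using that by (intro ev_extend free_gen_carrier M.R.is_cring) (auto simp: free_gen_def split: if_splits)
  also have "\<dots> = \<beta> m n" using that by (simp add: free_gen_def bil_closed)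
  finally show ?thesis .
qed

private lemma ev_rel: "ev h = \<zero>\<^bsub>P\<^esub>" if "h \<in> tensor_rel_space K M N"
proof -
  interpret ev: mod_hom K F P ev
    by (intro mod_hom.intro mod_hom_axioms.intro ev_hom F.module_axioms P.module_axioms)
  have minus: "ev (g \<ominus>\<^bsub>F\<^esub> h) = \<zero>\<^bsub>P\<^esub>" if "g \<in> carrier F" "h \<in> carrier F" "ev g = ev h" for g h
  proof -
    have "\<ominus>\<^bsub>F\<^esub> h = (\<ominus>\<^bsub>K\<^esub> \<one>\<^bsub>K\<^esub>) \<odot>\<^bsub>F\<^esub> h" using F.smult_l_minus[of "\<one>\<^bsub>K\<^esub>" h] that by simp
    then have "ev (\<ominus>\<^bsub>F\<^esub> h) = \<ominus>\<^bsub>P\<^esub> ev h"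
      using P.smult_l_minus[of "\<one>\<^bsub>K\<^esub>" "ev h"] that ev.f_smult[of "\<ominus>\<^bsub>K\<^esub> \<one>\<^bsub>K\<^esub>" h]
        module_hom_closed[OF ev_hom] by (auto simp: Pi_iff)
    then show ?thesis using that ev.f_add[of g "\<ominus>\<^bsub>F\<^esub> h"] module_hom_closed[OF ev_hom]
      by (auto simp: a_minus_def Pi_iff P.M.r_neg)
  qed
  have b: "m \<in> carrier M \<Longrightarrow> n \<in> carrier N \<Longrightarrow> n' \<in> carrier N \<Longrightarrow> \<beta> m (n \<oplus>\<^bsub>N\<^esub> n') = \<beta> m n \<oplus>\<^bsub>P\<^esub> \<beta> m n'"
    "m \<in> carrier M \<Longrightarrow> m' \<in> carrier M \<Longrightarrow> n \<in> carrier N \<Longrightarrow> \<beta> (m \<oplus>\<^bsub>M\<^esub> m') n = \<beta> m n \<oplus>\<^bsub>P\<^esub> \<beta> m' n"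
    "c \<in> carrier K \<Longrightarrow> m \<in> carrier M \<Longrightarrow> n \<in> carrier N \<Longrightarrow> \<beta> m (c \<odot>\<^bsub>N\<^esub> n) = c \<odot>\<^bsub>P\<^esub> \<beta> m n"
    "c \<in> carrier K \<Longrightarrow> m \<in> carrier M \<Longrightarrow> n \<in> carrier N \<Longrightarrow> \<beta> (c \<odot>\<^bsub>M\<^esub> m) n = c \<odot>\<^bsub>P\<^esub> \<beta> m n"
    for m m' n n' c
    using bil by (auto simp: bilinear_map_def module_hom_def)
  have gc: "free_gen K (m, n) \<in> carrier F" if "m \<in> carrier M" "n \<in> carrier N" for m n
    using that by (intro free_gen_carrier M.R.is_cring) auto
  have rel: "r \<in> carrier F \<and> ev r = \<zero>\<^bsub>P\<^esub>" if r: "r \<in> tensor_relations K M N" for r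
  proof
    show "r \<in> carrier F" using r tensor_relations_carrier[OF mods(1,2)] by blast
    have e: "ev (f \<oplus>\<^bsub>F\<^esub> g) = ev f \<oplus>\<^bsub>P\<^esub> ev g" if "f \<in> carrier F" "g \<in> carrier F" for f g
      using ev.f_add that by blast
    have s: "ev (c \<odot>\<^bsub>F\<^esub> g) = c \<odot>\<^bsub>P\<^esub> ev g" if "c \<in> carrier K" "g \<in> carrier F" for c g
      using ev.f_smult that by blast
    from r show "ev r = \<zero>\<^bsub>P\<^esub>"
      unfolding tensor_relations_def Let_def
      apply (elim UnE CollectE exE conjE; hypsubst)
         apply (rule minus; (simp only: e s gc ev_gen b M.M.a_closed N.M.a_closed M.smult_closed N.smult_closed F.M.a_closed F.smult_closed)?)+
      done
  qed
  have "submodule K {h \<in> carrier F. ev h = \<zero>\<^bsub>P\<^esub>} F"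
    using ev.ker_is_submodule by (simp add: ev.ker_def)
  then have "module.span K F (tensor_relations K M N) \<subseteq> {h \<in> carrier F. ev h = \<zero>\<^bsub>P\<^esub>}"
    using rel by (intro F.span_is_subset) auto
  then show ?thesis using that by (auto simp: tensor_rel_space_def)
qed

private lemma lift_coset:
  assumes "h \<in> carrier F"
  shows "tensor_lift K P \<beta> (tensor_rel_space K M N +>\<^bsub>F\<^esub> h) = ev h"
proof -
  interpret ev: mod_hom K F P ev
    by (intro mod_hom.intro mod_hom_axioms.intro ev_hom F.module_axioms P.module_axioms)
  interpret W: abelian_subgroup "tensor_rel_space K M N" F
    by (rule submodule_abelian_subgroup[OF F.module_axioms tensor_rel_submodule[OF mods(1,2)]])
  define g where "g = (SOME g. g \<in> tensor_rel_space K M N +>\<^bsub>F\<^esub> h)"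
  have "g \<in> tensor_rel_space K M N +>\<^bsub>F\<^esub> h"
    unfolding g_def by (rule someI[where P = "\<lambda>g. g \<in> _", OF W.a_rcos_self[OF assms]])
  then obtain w where w: "w \<in> tensor_rel_space K M N" "g = w \<oplus>\<^bsub>F\<^esub> h"
    by (auto simp: a_r_coset_defs)
  then have wc: "w \<in> carrier F" by simp
  have "ev g = ev w \<oplus>\<^bsub>P\<^esub> ev h" unfolding w(2) using ev.f_add[OF wc assms] .
  moreover have "ev h \<in> carrier P" using module_hom_closed[OF ev_hom] assms by (auto simp: Pi_iff)
  ultimately have "ev g = ev h" using ev_rel[OF w(1)] by simp
  then show ?thesis by (simp add: tensor_lift_def g_def[symmetric])
qed

lemma tensor_lift_pure:
  "m \<in> carrier M \<Longrightarrow> n \<in> carrier N \<Longrightarrow> tensor_lift K P \<beta> (pure_tensor K M N m n) = \<beta> m n"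
  unfolding pure_tensor_def
  by (subst lift_coset) (auto intro!: free_gen_carrier M.R.is_cring simp: ev_gen)

lemma tensor_lift_hom: "tensor_lift K P \<beta> \<in> module_hom K (tensor K M N) P"
proof -
  let ?W = "tensor_rel_space K M N"
  interpret ev: mod_hom K F P ev
    by (intro mod_hom.intro mod_hom_axioms.intro ev_hom F.module_axioms P.module_axioms)
  interpret W: abelian_subgroup ?W F
    by (rule submodule_abelian_subgroup[OF F.module_axioms tensor_rel_submodule[OF mods(1,2)]])
  have add: "(?W +>\<^bsub>F\<^esub> u) \<oplus>\<^bsub>tensor K M N\<^esub> (?W +>\<^bsub>F\<^esub> v) = ?W +>\<^bsub>F\<^esub> (u \<oplus>\<^bsub>F\<^esub> v)"
    if "u \<in> carrier F" "v \<in> carrier F" for u v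
    using W.a_rcos_sum[OF that] by (simp add: quotient_module_def tensor_def)
  have smult: "c \<odot>\<^bsub>tensor K M N\<^esub> (?W +>\<^bsub>F\<^esub> v) = ?W +>\<^bsub>F\<^esub> (c \<odot>\<^bsub>F\<^esub> v)"
    if "c \<in> carrier K" "v \<in> carrier F" for c v
    unfolding tensor_def
    using quotient_module_smult[OF F.module_axioms tensor_rel_submodule[OF mods(1,2)]] that .
  have carr: "carrier (tensor K M N) = (\<lambda>v. ?W +>\<^bsub>F\<^esub> v) ` carrier F"
    by (simp add: tensor_def quotient_module_carrier)
  show ?thesis
    unfolding module_hom_def
  proof (safe, goal_cases)
    case (1 t)
    then obtain v where v: "v \<in> carrier F" "t = ?W +>\<^bsub>F\<^esub> v" by (auto simp: carr)
    then show ?case using lift_coset module_hom_closed[OF ev_hom] by (auto simp: Pi_iff)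
  next
    case (2 s t)
    then obtain u v where "u \<in> carrier F" "s = ?W +>\<^bsub>F\<^esub> u" "v \<in> carrier F" "t = ?W +>\<^bsub>F\<^esub> v"
      by (auto simp: carr)
    then show ?case using ev.f_add by (simp only: add lift_coset F.M.a_closed)
  next
    case (3 c t)
    then obtain v where "v \<in> carrier F" "t = ?W +>\<^bsub>F\<^esub> v" by (auto simp: carr)
    then show ?case using 3 ev.f_smult by (simp only: smult lift_coset F.smult_closed)
  qed
qed

end


subsection \<open>Derived constructions\<close>

text \<open>\<open>f \<otimes> g\<close> as a map into \<open>M' \<otimes> N'\<close>.\<close>

definition tensor_map ::
    "('k, 'c) ring_scheme \<Rightarrow> ('k, 'm2, 'd) module_scheme \<Rightarrow> ('k, 'n2, 'e) module_scheme
      \<Rightarrow> ('m \<Rightarrow> 'm2) \<Rightarrow> ('n \<Rightarrow> 'n2) \<Rightarrow> ('m \<times> 'n \<Rightarrow> 'k) set \<Rightarrow> ('m2 \<times> 'n2 \<Rightarrow> 'k) set" where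
  "tensor_map K M' N' f g =
    tensor_lift K (tensor K M' N') (\<lambda>m n. pure_tensor K M' N' (f m) (g n))"

text \<open>The associativity isomorphism \<open>(L \<otimes> M) \<otimes> N \<rightarrow> L \<otimes> (M \<otimes> N)\<close>.\<close>

definition tensor_assoc ::
    "('k, 'c) ring_scheme \<Rightarrow> ('k, 'l, 'd) module_scheme \<Rightarrow> ('k, 'm, 'e) module_scheme
      \<Rightarrow> ('k, 'n, 'f) module_scheme
      \<Rightarrow> (('l \<times> 'm \<Rightarrow> 'k) set \<times> 'n \<Rightarrow> 'k) set \<Rightarrow> ('l \<times> ('m \<times> 'n \<Rightarrow> 'k) set \<Rightarrow> 'k) set" where
  "tensor_assoc K L M N = (let T = tensor K L (tensor K M N) in
     tensor_lift K T (\<lambda>t n.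
       tensor_lift K T (\<lambda>l m. pure_tensor K L (tensor K M N) l (pure_tensor K M N m n)) t))"

text \<open>The algebra \<open>A \<otimes> B\<close>, with \<open>(a \<otimes> b)(c \<otimes> d) = ac \<otimes> bd\<close>.\<close>

definition tensor_algebra ::
    "('k, 'c) ring_scheme \<Rightarrow> ('k, 'a, 'd) module_scheme \<Rightarrow> ('k, 'b, 'e) module_scheme
      \<Rightarrow> ('k, ('a \<times> 'b \<Rightarrow> 'k) set) module" where
  "tensor_algebra K A B = (let T = tensor K A B in
     T\<lparr>mult := (\<lambda>s t. tensor_lift K T (\<lambda>a b.
                 tensor_lift K T (\<lambda>c d. pure_tensor K A B (a \<otimes>\<^bsub>A\<^esub> c) (b \<otimes>\<^bsub>B\<^esub> d)) t) s),
       one := pure_tensor K A B \<one>\<^bsub>A\<^esub> \<one>\<^bsub>B\<^esub>\<rparr>)"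

text \<open>
  For subspaces \<open>N \<subseteq> M\<close> and \<open>X \<subseteq> A\<close>, the subspace \<open>N \<otimes> X \<subseteq> M \<otimes> A\<close>: the image of the map
  \<open>N \<otimes> X \<rightarrow> M \<otimes> A\<close> induced by the inclusions (which is injective over a field).
\<close>

definition tensor_sub ::
    "('k, 'c) ring_scheme \<Rightarrow> ('k, 'm, 'd) module_scheme \<Rightarrow> ('k, 'a, 'e) module_scheme
      \<Rightarrow> 'm set \<Rightarrow> 'a set \<Rightarrow> ('m \<times> 'a \<Rightarrow> 'k) set set" where
  "tensor_sub K M A N X =
    tensor_map K M A (\<lambda>m. m) (\<lambda>a. a) ` carrier (tensor K (M\<lparr>carrier := N\<rparr>) (A\<lparr>carrier := X\<rparr>))"


section \<open>Affine group schemes\<close>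

text \<open>The analogue of \<open>semiring_char\<close> for rings with an explicit carrier.\<close>

definition characteristic :: "('k, 'c) ring_scheme \<Rightarrow> nat" where
  "characteristic K = Gcd {n. [n] \<cdot>\<^bsub>K\<^esub> \<one>\<^bsub>K\<^esub> = \<zero>\<^bsub>K\<^esub>}"

definition algebra_hom ::
    "('k, 'c) ring_scheme \<Rightarrow> ('k, 'a, 'd) module_scheme \<Rightarrow> ('k, 'b, 'e) module_scheme
      \<Rightarrow> ('a \<Rightarrow> 'b) set" where
  "algebra_hom K A B = ring_hom A B \<inter> module_hom K A B"

text \<open>
  An affine group scheme \<open>\<bbbG>\<close> over the field \<open>K\<close> is given by its coordinate algebra \<open>A = \<O>(\<bbbG>)\<close>, a
  commutative Hopf algebra: \<open>\<Delta>\<close>, \<open>\<epsilon>\<close> and \<open>S\<close> are the comorphisms of the multiplication, the unit and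
  the inversion of \<open>\<bbbG>\<close>.
\<close>

locale affine_group_scheme =
  fixes K :: "'k ring" and A :: "('k, 'a) module"
    and \<Delta> :: "'a \<Rightarrow> ('a \<times> 'a \<Rightarrow> 'k) set" and \<epsilon> :: "'a \<Rightarrow> 'k" and S :: "'a \<Rightarrow> 'a"
  assumes field: "field K"
    and algebra: "algebra K A"
    and comult_hom: "\<Delta> \<in> algebra_hom K A (tensor_algebra K A A)"
    and counit_hom: "\<epsilon> \<in> ring_hom A K"
    and counit_scalar: "\<lbrakk>c \<in> carrier K; a \<in> carrier A\<rbrakk> \<Longrightarrow> \<epsilon> (c \<odot>\<^bsub>A\<^esub> a) = c \<otimes>\<^bsub>K\<^esub> \<epsilon> a"
    and antipode_hom: "S \<in> algebra_hom K A A"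
    and coassoc: "a \<in> carrier A \<Longrightarrow>
      tensor_assoc K A A A (tensor_map K (tensor K A A) A \<Delta> (\<lambda>x. x) (\<Delta> a))
      = tensor_map K A (tensor K A A) (\<lambda>x. x) \<Delta> (\<Delta> a)"
    and counit_left: "a \<in> carrier A \<Longrightarrow> tensor_lift K A (\<lambda>x y. \<epsilon> x \<odot>\<^bsub>A\<^esub> y) (\<Delta> a) = a"
    and counit_right: "a \<in> carrier A \<Longrightarrow> tensor_lift K A (\<lambda>x y. \<epsilon> y \<odot>\<^bsub>A\<^esub> x) (\<Delta> a) = a"
    and antipode_left: "a \<in> carrier A \<Longrightarrow>
      tensor_lift K A (\<lambda>x y. S x \<otimes>\<^bsub>A\<^esub> y) (\<Delta> a) = \<epsilon> a \<odot>\<^bsub>A\<^esub> \<one>\<^bsub>A\<^esub>"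
    and antipode_right: "a \<in> carrier A \<Longrightarrow>
      tensor_lift K A (\<lambda>x y. x \<otimes>\<^bsub>A\<^esub> S y) (\<Delta> a) = \<epsilon> a \<odot>\<^bsub>A\<^esub> \<one>\<^bsub>A\<^esub>"

text \<open>The \<open>K\<close>-subalgebra generated by \<open>G\<close> is the subring generated by \<open>G\<close> and the scalars.\<close>

definition finitely_generated_algebra ::
    "('k, 'c) ring_scheme \<Rightarrow> ('k, 'a, 'd) module_scheme \<Rightarrow> bool" where
  "finitely_generated_algebra K A \<longleftrightarrow>
    (\<exists>G. finite G \<and> G \<subseteq> carrier A \<and>
      generate_ring A (G \<union> {c \<odot>\<^bsub>A\<^esub> \<one>\<^bsub>A\<^esub> | c. c \<in> carrier K}) = carrier A)"

locale finite_type_group_scheme = affine_group_scheme +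
  assumes finite_type: "finitely_generated_algebra K A"

definition ascending_converging ::
    "'k ring \<Rightarrow> ('k, 'a) module \<Rightarrow> (nat \<Rightarrow> 'a set) \<Rightarrow> bool" where
  "ascending_converging K A X \<longleftrightarrow>
    (\<forall>i. subspace K (X i) A) \<and> (\<forall>i. X i \<subseteq> X (Suc i)) \<and> (\<Union>i. X i) = carrier A"


section \<open>Modules of a group scheme\<close>

text \<open>A \<open>\<bbbG>\<close>-module is a right \<open>\<O>(\<bbbG>)\<close>-comodule \<open>M\<close> with coaction \<open>\<delta>\<close>, of arbitrary dimension.\<close>

locale group_scheme_module = affine_group_scheme K A \<Delta> \<epsilon> S
  for K :: "'k ring" and A :: "('k, 'a) module" and \<Delta> \<epsilon> S +
  fixes M :: "('k, 'm) module" and \<delta> :: "'m \<Rightarrow> ('m \<times> 'a \<Rightarrow> 'k) set"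
  assumes vectorspace: "vectorspace K M"
    and coaction_linear: "\<delta> \<in> module_hom K M (tensor K M A)"
    and coaction_coassoc: "m \<in> carrier M \<Longrightarrow>
      tensor_assoc K M A A (tensor_map K (tensor K M A) A \<delta> (\<lambda>x. x) (\<delta> m))
      = tensor_map K M (tensor K A A) (\<lambda>x. x) \<Delta> (\<delta> m)"
    and coaction_counit: "m \<in> carrier M \<Longrightarrow> tensor_lift K M (\<lambda>x a. \<epsilon> a \<odot>\<^bsub>M\<^esub> x) (\<delta> m) = m"

definition module_morphism ::
    "'k ring \<Rightarrow> ('k, 'a) module \<Rightarrow> ('k, 'm) module \<Rightarrow> ('m \<Rightarrow> ('m \<times> 'a \<Rightarrow> 'k) set)
      \<Rightarrow> ('k, 'n) module \<Rightarrow> ('n \<Rightarrow> ('n \<times> 'a \<Rightarrow> 'k) set) \<Rightarrow> ('m \<Rightarrow> 'n) \<Rightarrow> bool" where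
  "module_morphism K A M \<delta> N \<eta> f \<longleftrightarrow> f \<in> module_hom K M N \<and>
    (\<forall>m\<in>carrier M. \<eta> (f m) = tensor_map K N A f (\<lambda>a. a) (\<delta> m))"

text \<open>
  A \<open>\<bbbG>\<close>-submodule \<open>N\<close> of \<open>M\<close> has as its coaction the restriction \<open>N \<rightarrow> N \<otimes> A \<subseteq> M \<otimes> A\<close> of \<open>\<delta>\<close>; it is
  an \<open>X\<close>-comodule if this coaction factors through \<open>N \<otimes> X \<subseteq> N \<otimes> A\<close>.
\<close>

definition is_submodule ::
    "'k ring \<Rightarrow> ('k, 'a) module \<Rightarrow> ('k, 'm) module \<Rightarrow> ('m \<Rightarrow> ('m \<times> 'a \<Rightarrow> 'k) set)
      \<Rightarrow> 'm set \<Rightarrow> bool" where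
  "is_submodule K A M \<delta> N \<longleftrightarrow> subspace K N M \<and> \<delta> ` N \<subseteq> tensor_sub K M A N (carrier A)"

definition is_comodule_for ::
    "'k ring \<Rightarrow> ('k, 'a) module \<Rightarrow> ('k, 'm) module \<Rightarrow> ('m \<Rightarrow> ('m \<times> 'a \<Rightarrow> 'k) set)
      \<Rightarrow> 'a set \<Rightarrow> 'm set \<Rightarrow> bool" where
  "is_comodule_for K A M \<delta> X N \<longleftrightarrow> is_submodule K A M \<delta> N \<and> \<delta> ` N \<subseteq> tensor_sub K M A N X"

text \<open>The subspace \<open>M\<^sub>X\<close>.\<close>

definition comodule_part ::
    "'k ring \<Rightarrow> ('k, 'a) module \<Rightarrow> ('k, 'm) module \<Rightarrow> ('m \<Rightarrow> ('m \<times> 'a \<Rightarrow> 'k) set)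
      \<Rightarrow> 'a set \<Rightarrow> 'm set" where
  "comodule_part K A M \<delta> X = \<Union> {N. is_comodule_for K A M \<delta> X N}"

end

theory Submission
  imports Defs
begin

text \<open>
  Everything rests on the local finiteness of \<open>\<bbbG>\<close>-modules: each \<open>m \<in> M\<close> lies in a \<open>\<bbbG>\<close>-submodule
  spanned by finitely many vectors.  Granted that, the coaction sends each of finitely many generators
  of a submodule \<open>N\<close> into \<open>N \<otimes> A = \<Union>\<^sub>i N \<otimes> X\<^sub>i\<close> (\<open>tensor_sub_directed_union\<close>), hence all of them into
  one \<open>N \<otimes> X\<^sub>i\<close>, and then all of \<open>N\<close> by linearity (\<open>finite_span_eventually_comodule\<close>).  With \<open>N = M\<close>
  this is the statement on finite dimensional modules; with \<open>N\<close> a finitely spanned submodule around a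
  given vector it shows that the \<open>M\<^bsub>X\<^sub>i\<^esub>\<close> exhaust \<open>M\<close>.  That \<open>M\<^sub>X\<close> is itself an \<open>X\<close>-comodule holds because
  the \<open>X\<close>-comodules inside \<open>M\<close> form a directed family: a sum of two of them is another.  Functoriality
  holds because a morphism \<open>f\<close> carries \<open>N \<otimes> X\<close> into \<open>f(N) \<otimes> X\<close>.

  For local finiteness (\<open>locally_finite\<close>), a linear functional \<open>\<phi>\<close> on \<open>A\<close> gives the contraction
  \<open>id \<otimes> \<phi> : M \<otimes> A \<rightarrow> M\<close>.  A tensor \<open>t\<close> lies in \<open>N \<otimes> A\<close> for a subspace \<open>N\<close> spanned by finitely many
  contractions of \<open>t\<close> (\<open>finite_contractions_generate\<close>): if \<open>t = \<Sum>\<^sub>j x\<^sub>j \<otimes> b\<^sub>j\<close> with independent \<open>b\<^sub>j\<close>,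
  then each \<open>x\<^sub>j\<close> is the contraction of \<open>t\<close> with a functional dual to \<open>b\<^sub>j\<close>.  For \<open>t = \<delta> m\<close>,
  coassociativity gives
  \<open>\<delta> ((id \<otimes> \<phi>) (\<delta> m)) = (id \<otimes> id \<otimes> \<phi>) ((id \<otimes> \<Delta>) (\<delta> m)) \<in> N \<otimes> A\<close>,
  so that \<open>N\<close> is a submodule, and the counit axiom \<open>m = (id \<otimes> \<epsilon>) (\<delta> m)\<close> puts \<open>m\<close> into \<open>N\<close>.
\<close>

section \<open>Linear maps and submodules\<close>

lemma submoduleI:
  assumes "module K V" "W \<subseteq> carrier V" "\<zero>\<^bsub>V\<^esub> \<in> W"
    and "\<And>v w. v \<in> W \<Longrightarrow> w \<in> W \<Longrightarrow> v \<oplus>\<^bsub>V\<^esub> w \<in> W"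
    and "\<And>c v. c \<in> carrier K \<Longrightarrow> v \<in> W \<Longrightarrow> c \<odot>\<^bsub>V\<^esub> v \<in> W"
  shows "submodule K W V"
  using assms by (intro submodule.intro)

lemma submodule_carrier: "module K V \<Longrightarrow> submodule K (carrier V) V"
  by (intro submoduleI) (auto simp: module_def abelian_group_def abelian_monoid.a_closed
      abelian_monoid.zero_closed module_axioms_def)

lemma module_hom_apply: "f \<in> module_hom K V W \<Longrightarrow> v \<in> carrier V \<Longrightarrow> f v \<in> carrier W"
  by (auto simp: module_hom_def)

lemma module_hom_zero:
  assumes "module K V" "module K W" "f \<in> module_hom K V W"
  shows "f \<zero>\<^bsub>V\<^esub> = \<zero>\<^bsub>W\<^esub>"
proof -
  interpret mod_hom K V W f
    using assms by (intro mod_hom.intro mod_hom_axioms.intro)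
  show ?thesis by simp
qed

lemma module_hom_comp:
  "f \<in> module_hom K U V \<Longrightarrow> g \<in> module_hom K V W \<Longrightarrow> (\<lambda>u. g (f u)) \<in> module_hom K U W"
  by (auto simp: module_hom_def Pi_iff)

lemma identity_module_hom: "module K V \<Longrightarrow> (\<lambda>v. v) \<in> module_hom K V V"
  by (auto simp: module_hom_def)

lemma submodule_preimage:
  assumes "module K V" "module K W" "f \<in> module_hom K V W" "submodule K Y W"
  shows "submodule K {v \<in> carrier V. f v \<in> Y} V"
proof -
  interpret V: module K V by fact
  interpret Y: submodule K Y W by fact
  show ?thesis
    by (rule submoduleI[OF assms(1)])
       (use assms in \<open>auto simp: module_hom_zero module_hom_add module_hom_smult\<close>)
qed

lemma submodule_image:
  assumes "module K V" "module K W" "f \<in> module_hom K V W" "submodule K Y V"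
  shows "submodule K (f ` Y) W"
proof -
  interpret Y: submodule K Y V by fact
  have Y: "y \<in> carrier V" if "y \<in> Y" for y using Y.subset that by blast
  show ?thesis
  proof (rule submoduleI[OF assms(2)])
    show "f ` Y \<subseteq> carrier W" using Y assms(3) by (auto intro: module_hom_apply)
    show "\<zero>\<^bsub>W\<^esub> \<in> f ` Y"
      using module_hom_zero[OF assms(1-3)] Y.zero_closed by (metis imageI)
    show "v \<oplus>\<^bsub>W\<^esub> w \<in> f ` Y" if vw: "v \<in> f ` Y" "w \<in> f ` Y" for v w
    proof -
      obtain x y where "x \<in> Y" "y \<in> Y" "v = f x" "w = f y" using vw by blast
      then show ?thesis using Y module_hom_add[OF assms(3)] by (intro image_eqI[of _ _ "x \<oplus>\<^bsub>V\<^esub> y"]) auto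
    qed
    show "c \<odot>\<^bsub>W\<^esub> v \<in> f ` Y" if cv: "c \<in> carrier K" "v \<in> f ` Y" for c v
    proof -
      obtain y where "y \<in> Y" "v = f y" using cv by blast
      then show ?thesis using cv Y module_hom_smult[OF assms(3)] by (intro image_eqI[of _ _ "c \<odot>\<^bsub>V\<^esub> y"]) auto
    qed
  qed
qed

lemma submodule_equalizer:
  assumes "module K V" "module K W" "f \<in> module_hom K V W" "g \<in> module_hom K V W"
  shows "submodule K {v \<in> carrier V. f v = g v} V"
proof -
  interpret V: module K V by fact
  show ?thesis
    by (rule submoduleI[OF assms(1)])
       (use assms in \<open>auto simp: module_hom_zero module_hom_add module_hom_smult\<close>)
qed

lemma module_hom_plus:
  assumes "module K V" "module K W" "f \<in> module_hom K V W" "g \<in> module_hom K V W"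
  shows "(\<lambda>v. f v \<oplus>\<^bsub>W\<^esub> g v) \<in> module_hom K V W"
proof -
  interpret V: module K V by fact
  interpret W: module K W by fact
  show ?thesis
    using module_hom_apply[OF assms(3)] module_hom_apply[OF assms(4)]
      module_hom_add[OF assms(3)] module_hom_add[OF assms(4)]
      module_hom_smult[OF assms(3)] module_hom_smult[OF assms(4)]
    unfolding module_hom_def by (auto simp: W.M.a_ac W.smult_r_distr)
qed

lemma module_hom_smult_const:
  assumes "module K V" "module K W" "f \<in> module_hom K V W" "c \<in> carrier K"
  shows "(\<lambda>v. c \<odot>\<^bsub>W\<^esub> f v) \<in> module_hom K V W"
proof -
  interpret V: module K V by fact
  interpret W: module K W by fact
  have "c \<odot>\<^bsub>W\<^esub> (r \<odot>\<^bsub>W\<^esub> f v) = r \<odot>\<^bsub>W\<^esub> (c \<odot>\<^bsub>W\<^esub> f v)" if "r \<in> carrier K" "v \<in> carrier V" for r v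
    using that assms(4) module_hom_apply[OF assms(3)]
    by (simp add: W.smult_assoc1[symmetric] V.R.m_comm)
  then show ?thesis
    using module_hom_apply[OF assms(3)] module_hom_add[OF assms(3)] module_hom_smult[OF assms(3)] assms(4)
    unfolding module_hom_def by (auto simp: W.smult_r_distr)
qed

section \<open>Tensor products\<close>

lemma quotient_map_hom:
  assumes "module K V" "submodule K W V"
  shows "(\<lambda>v. W +>\<^bsub>V\<^esub> v) \<in> module_hom K V (quotient_module V W)"
proof -
  interpret module K V by fact
  interpret abelian_subgroup W V by (rule submodule_abelian_subgroup) fact+
  show ?thesis unfolding module_hom_def mem_Collect_eq
  proof (intro conjI allI impI funcsetI; (elim conjE)?)
    show "W +>\<^bsub>V\<^esub> v \<in> carrier (quotient_module V W)" if "v \<in> carrier V" for v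
      using that unfolding quotient_module_carrier by (rule imageI)
    show "W +>\<^bsub>V\<^esub> (u \<oplus>\<^bsub>V\<^esub> v) = (W +>\<^bsub>V\<^esub> u) \<oplus>\<^bsub>quotient_module V W\<^esub> (W +>\<^bsub>V\<^esub> v)"
      if "u \<in> carrier V" "v \<in> carrier V" for u v
      using a_rcos_sum[OF that] by (simp add: quotient_module_def)
    show "W +>\<^bsub>V\<^esub> (c \<odot>\<^bsub>V\<^esub> v) = c \<odot>\<^bsub>quotient_module V W\<^esub> (W +>\<^bsub>V\<^esub> v)"
      if "c \<in> carrier K" "v \<in> carrier V" for c v
      using quotient_module_smult[OF assms that] by simp
  qed
qed

lemma quotient_map_eqI:
  assumes "module K V" "submodule K W V" "u \<in> carrier V" "v \<in> carrier V" "u \<ominus>\<^bsub>V\<^esub> v \<in> W"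
  shows "W +>\<^bsub>V\<^esub> u = W +>\<^bsub>V\<^esub> v"
proof -
  interpret module K V by fact
  interpret abelian_subgroup W V by (rule submodule_abelian_subgroup) fact+
  have "u \<in> W +>\<^bsub>V\<^esub> v" using assms by (intro a_rcos_module_rev) (auto simp: a_minus_def)
  then show ?thesis using assms by (intro a_repr_independence'[symmetric]) auto
qed

text \<open>
  Induction on a finite set containing the support of an element: subtracting its value at one
  point, times the generator there, shrinks the support.
\<close>

lemma free_module_generated:
  assumes "cring K" "submodule K W (free_module K B)" "\<And>b. b \<in> B \<Longrightarrow> free_gen K b \<in> W"
  shows "carrier (free_module K B) \<subseteq> W"
proof -
  interpret K: cring K by fact
  interpret W: submodule K W "free_module K B" by fact
  have "f \<in> W" if "finite D" "f \<in> carrier (free_module K B)" "{b. f b \<noteq> \<zero>\<^bsub>K\<^esub>} \<subseteq> D" for D f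
    using that
  proof (induction D arbitrary: f rule: finite_induct)
    case empty
    then have "f = \<zero>\<^bsub>free_module K B\<^esub>" by (auto simp: free_module_def)
    then show ?case using W.zero_closed by simp
  next
    case (insert d D)
    have f: "f b \<in> carrier K" for b using insert.prems by (auto simp: free_module_def)
    let ?g = "\<lambda>b. if b = d then \<zero>\<^bsub>K\<^esub> else f b"
    have "finite {b. ?g b \<noteq> \<zero>\<^bsub>K\<^esub>}" "{b. ?g b \<noteq> \<zero>\<^bsub>K\<^esub>} \<subseteq> B"
      using insert.prems by (auto simp: free_module_def intro: rev_finite_subset)
    then have g: "?g \<in> W" using insert.prems f by (intro insert.IH) (auto simp: free_module_def)
    show ?case
    proof (cases "f d = \<zero>\<^bsub>K\<^esub>")
      case True
      then have "?g = f" by auto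
      then show ?thesis using g by simp
    next
      case False
      then have "d \<in> B" using insert.prems by (auto simp: free_module_def)
      then have "?g \<oplus>\<^bsub>free_module K B\<^esub> f d \<odot>\<^bsub>free_module K B\<^esub> free_gen K d \<in> W"
        using g f assms(3) by (intro W.m_closed W.smult_closed)
      moreover have "f = ?g \<oplus>\<^bsub>free_module K B\<^esub> f d \<odot>\<^bsub>free_module K B\<^esub> free_gen K d"
        using f by (auto simp: free_module_def free_gen_def)
      ultimately show ?thesis by simp
    qed
  qed
  then show ?thesis by (auto simp: free_module_def)
qed

text \<open>
  The induction principle for tensors.  It is phrased with a submodule, because the properties to be
  proved of all tensors below (equality of two linear maps, membership of an image in a subspace) are
  preimages or equalizers, which are submodules for general reasons.
\<close>

lemma tensor_generated:
  assumes "module K M" "module K N" "submodule K W (tensor K M N)"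
    and "\<And>m n. m \<in> carrier M \<Longrightarrow> n \<in> carrier N \<Longrightarrow> pure_tensor K M N m n \<in> W"
  shows "carrier (tensor K M N) \<subseteq> W"
proof -
  interpret M: module K M by fact
  let ?F = "free_module K (carrier M \<times> carrier N)" and ?R = "tensor_rel_space K M N"
  have F: "module K ?F" by (rule free_module_module) (rule M.R.is_cring)
  have hom: "(\<lambda>v. ?R +>\<^bsub>?F\<^esub> v) \<in> module_hom K ?F (tensor K M N)"
    unfolding tensor_def by (rule quotient_map_hom[OF F tensor_rel_submodule[OF assms(1,2)]])
  have "carrier ?F \<subseteq> {v \<in> carrier ?F. ?R +>\<^bsub>?F\<^esub> v \<in> W}"
    using assms(4) M.R.is_cring
    by (intro free_module_generated submodule_preimage[OF F tensor_module[OF assms(1,2)] hom assms(3)])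
       (auto simp: pure_tensor_def intro: free_gen_carrier)
  then show ?thesis by (auto simp: tensor_def quotient_module_carrier)
qed

text \<open>
  Each instance of additivity or homogeneity is one of the relations divided out.
\<close>

lemma pure_tensor_bilinear:
  assumes "module K M" "module K N"
  shows "bilinear_map K M N (tensor K M N) (pure_tensor K M N)"
proof -
  interpret M: module K M by fact
  interpret N: module K N by fact
  let ?F = "free_module K (carrier M \<times> carrier N)" and ?R = "tensor_rel_space K M N"
  interpret F: module K ?F by (rule free_module_module) (rule M.R.is_cring)
  note F = F.module_axioms and R = tensor_rel_submodule[OF assms]
  have hom: "(\<lambda>v. ?R +>\<^bsub>?F\<^esub> v) \<in> module_hom K ?F (tensor K M N)"
    unfolding tensor_def by (rule quotient_map_hom[OF F R])
  have gc: "free_gen K (m, n) \<in> carrier ?F" if "m \<in> carrier M" "n \<in> carrier N" for m n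
    using that by (intro free_gen_carrier M.R.is_cring) auto
  have rel: "r \<in> ?R" if "r \<in> tensor_relations K M N" for r
    using F.in_own_span[OF tensor_relations_carrier[OF assms]] that
    by (auto simp: tensor_rel_space_def)
  note [simp] = pure_tensor_def module_hom_add[OF hom, symmetric] module_hom_smult[OF hom, symmetric]
  have 1: "pure_tensor K M N (m \<oplus>\<^bsub>M\<^esub> m') n = pure_tensor K M N m n \<oplus>\<^bsub>tensor K M N\<^esub> pure_tensor K M N m' n"
    if "m \<in> carrier M" "m' \<in> carrier M" "n \<in> carrier N" for m m' n
    using that by (simp add: gc) (rule quotient_map_eqI[OF F R _ _ rel], simp_all add: gc, unfold tensor_relations_def Let_def, blast)
  have 2: "pure_tensor K M N m (n \<oplus>\<^bsub>N\<^esub> n') = pure_tensor K M N m n \<oplus>\<^bsub>tensor K M N\<^esub> pure_tensor K M N m n'"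
    if "m \<in> carrier M" "n \<in> carrier N" "n' \<in> carrier N" for m n n'
    using that by (simp add: gc) (rule quotient_map_eqI[OF F R _ _ rel], simp_all add: gc, unfold tensor_relations_def Let_def, blast)
  have 3: "pure_tensor K M N (c \<odot>\<^bsub>M\<^esub> m) n = c \<odot>\<^bsub>tensor K M N\<^esub> pure_tensor K M N m n"
    if "c \<in> carrier K" "m \<in> carrier M" "n \<in> carrier N" for c m n
    using that by (simp add: gc) (rule quotient_map_eqI[OF F R _ _ rel], simp_all add: gc, unfold tensor_relations_def Let_def, blast)
  have 4: "pure_tensor K M N m (c \<odot>\<^bsub>N\<^esub> n) = c \<odot>\<^bsub>tensor K M N\<^esub> pure_tensor K M N m n"
    if "c \<in> carrier K" "m \<in> carrier M" "n \<in> carrier N" for c m n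
    using that by (simp add: gc) (rule quotient_map_eqI[OF F R _ _ rel], simp_all add: gc, unfold tensor_relations_def Let_def, blast)
  have 5: "pure_tensor K M N m n \<in> carrier (tensor K M N)" if "m \<in> carrier M" "n \<in> carrier N" for m n
    using module_hom_apply[OF hom gc[OF that]] by simp
  show ?thesis
    unfolding bilinear_map_def module_hom_def using 1 2 3 4 5 by (auto simp del: pure_tensor_def)
qed

lemma tensor_hom_eqI:
  assumes "module K M" "module K N" "module K P"
    and "f \<in> module_hom K (tensor K M N) P" "g \<in> module_hom K (tensor K M N) P"
    and "\<And>m n. m \<in> carrier M \<Longrightarrow> n \<in> carrier N \<Longrightarrow>
      f (pure_tensor K M N m n) = g (pure_tensor K M N m n)"
    and "t \<in> carrier (tensor K M N)"
  shows "f t = g t"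
proof -
  have "carrier (tensor K M N) \<subseteq> {t \<in> carrier (tensor K M N). f t = g t}"
    using pure_tensor_bilinear[OF assms(1,2)] assms
    by (intro tensor_generated submodule_equalizer tensor_module)
       (auto simp: bilinear_map_def dest: module_hom_apply)
  then show ?thesis using assms(7) by blast
qed

lemma pure_tensor_hom:
  assumes "module K M" "module K N"
  shows pure_tensor_hom_left: "n \<in> carrier N \<Longrightarrow> (\<lambda>m. pure_tensor K M N m n) \<in> module_hom K M (tensor K M N)"
    and pure_tensor_hom_right: "m \<in> carrier M \<Longrightarrow> pure_tensor K M N m \<in> module_hom K N (tensor K M N)"
    and pure_tensor_closed: "m \<in> carrier M \<Longrightarrow> n \<in> carrier N \<Longrightarrow> pure_tensor K M N m n \<in> carrier (tensor K M N)"
  using pure_tensor_bilinear[OF assms] by (auto simp: bilinear_map_def dest: module_hom_apply)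

lemma bilinear_map_comp:
  assumes "bilinear_map K M' N' P \<beta>" "f \<in> module_hom K M M'" "g \<in> module_hom K N N'"
  shows "bilinear_map K M N P (\<lambda>m n. \<beta> (f m) (g n))"
  unfolding bilinear_map_def
proof safe
  fix m assume "m \<in> carrier M"
  then have "\<beta> (f m) \<in> module_hom K N' P"
    using assms module_hom_apply[OF assms(2)] by (simp add: bilinear_map_def)
  then show "(\<lambda>n. \<beta> (f m) (g n)) \<in> module_hom K N P" by (rule module_hom_comp[OF assms(3)])
next
  fix n assume "n \<in> carrier N"
  then have "(\<lambda>m. \<beta> m (g n)) \<in> module_hom K M' P"
    using assms module_hom_apply[OF assms(3)] by (simp add: bilinear_map_def)
  then show "(\<lambda>m. \<beta> (f m) (g n)) \<in> module_hom K M P" by (rule module_hom_comp[OF assms(2)])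
qed

lemma tensor_map:
  assumes "module K M" "module K N" "module K M'" "module K N'"
    and "f \<in> module_hom K M M'" "g \<in> module_hom K N N'"
  shows tensor_map_hom: "tensor_map K M' N' f g \<in> module_hom K (tensor K M N) (tensor K M' N')"
    and tensor_map_pure: "m \<in> carrier M \<Longrightarrow> n \<in> carrier N \<Longrightarrow>
      tensor_map K M' N' f g (pure_tensor K M N m n) = pure_tensor K M' N' (f m) (g n)"
proof -
  note b = bilinear_map_comp[OF pure_tensor_bilinear[OF assms(3,4)] assms(5,6)]
  show "tensor_map K M' N' f g \<in> module_hom K (tensor K M N) (tensor K M' N')"
    unfolding tensor_map_def
    by (rule tensor_lift_hom[OF assms(1,2) tensor_module[OF assms(3,4)] b])
  show "m \<in> carrier M \<Longrightarrow> n \<in> carrier N \<Longrightarrow>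
      tensor_map K M' N' f g (pure_tensor K M N m n) = pure_tensor K M' N' (f m) (g n)"
    unfolding tensor_map_def
    by (rule tensor_lift_pure[OF assms(1,2) tensor_module[OF assms(3,4)] b])
qed

text \<open>
  The associator is a lift of a lift.  The outer lift is legitimate only if the inner one depends
  linearly on \<open>n\<close>; for a fixed \<open>t \<in> L \<otimes> M\<close> this is an identity between linear maps in \<open>t\<close>, so it is
  enough to know it for pure \<open>t\<close>.
\<close>

lemma tensor_assoc:
  assumes mods: "module K L" "module K M" "module K N"
  shows tensor_assoc_hom: "tensor_assoc K L M N \<in>
      module_hom K (tensor K (tensor K L M) N) (tensor K L (tensor K M N))"
    and tensor_assoc_pure: "l \<in> carrier L \<Longrightarrow> m \<in> carrier M \<Longrightarrow> n \<in> carrier N \<Longrightarrow>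
      tensor_assoc K L M N (pure_tensor K (tensor K L M) N (pure_tensor K L M l m) n)
      = pure_tensor K L (tensor K M N) l (pure_tensor K M N m n)"
proof -
  let ?T = "tensor K L (tensor K M N)"
  define \<beta> where "\<beta> n = (\<lambda>l m. pure_tensor K L (tensor K M N) l (pure_tensor K M N m n))" for n
  define I where "I n = tensor_lift K ?T (\<beta> n)" for n
  interpret N: module K N by fact
  note LM = tensor_module[OF mods(1,2)] and MN = tensor_module[OF mods(2,3)]
  note T = tensor_module[OF mods(1) MN]
  interpret T: module K ?T by (rule T)
  have \<beta>: "bilinear_map K L M ?T (\<beta> n)" if "n \<in> carrier N" for n
    unfolding \<beta>_def
    by (rule bilinear_map_comp[OF pure_tensor_bilinear[OF mods(1) MN] identity_module_hom[OF mods(1)]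
          pure_tensor_hom_left[OF mods(2,3) that]])
  have I_hom: "I n \<in> module_hom K (tensor K L M) ?T" if "n \<in> carrier N" for n
    unfolding I_def by (rule tensor_lift_hom[OF mods(1,2) T \<beta>[OF that]])
  have I_pure: "I n (pure_tensor K L M l m) = \<beta> n l m"
    if "l \<in> carrier L" "m \<in> carrier M" "n \<in> carrier N" for l m n
    unfolding I_def by (rule tensor_lift_pure[OF mods(1,2) T \<beta>[OF that(3)] that(1,2)])
  have \<beta>_hom: "(\<lambda>n. \<beta> n l m) \<in> module_hom K N ?T" if "l \<in> carrier L" "m \<in> carrier M" for l m
    unfolding \<beta>_def
    by (rule module_hom_comp[OF pure_tensor_hom_right[OF mods(2,3) that(2)]
          pure_tensor_hom_right[OF mods(1) MN that(1)]])
  have "(\<lambda>n. I n t) \<in> module_hom K N ?T" if t: "t \<in> carrier (tensor K L M)" for t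
  proof -
    have "I (n \<oplus>\<^bsub>N\<^esub> n') t = I n t \<oplus>\<^bsub>?T\<^esub> I n' t" if n: "n \<in> carrier N" "n' \<in> carrier N" for n n'
    proof (rule tensor_hom_eqI[OF mods(1,2) T I_hom module_hom_plus[OF LM T I_hom I_hom] _ t])
      fix l m assume "l \<in> carrier L" "m \<in> carrier M"
      then show "I (n \<oplus>\<^bsub>N\<^esub> n') (pure_tensor K L M l m)
          = I n (pure_tensor K L M l m) \<oplus>\<^bsub>?T\<^esub> I n' (pure_tensor K L M l m)"
        using n module_hom_add[OF \<beta>_hom n] by (simp add: I_pure)
    qed (use n in simp_all)
    moreover have "I (c \<odot>\<^bsub>N\<^esub> n) t = c \<odot>\<^bsub>?T\<^esub> I n t" if n: "c \<in> carrier K" "n \<in> carrier N" for c n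
    proof (rule tensor_hom_eqI[OF mods(1,2) T I_hom module_hom_smult_const[OF LM T I_hom] _ t])
      fix l m assume "l \<in> carrier L" "m \<in> carrier M"
      then show "I (c \<odot>\<^bsub>N\<^esub> n) (pure_tensor K L M l m) = c \<odot>\<^bsub>?T\<^esub> I n (pure_tensor K L M l m)"
        using n module_hom_smult[OF \<beta>_hom n] by (simp add: I_pure)
    qed (use n in simp_all)
    ultimately show ?thesis using module_hom_apply[OF I_hom t] by (auto simp: module_hom_def)
  qed
  then have b: "bilinear_map K (tensor K L M) N ?T (\<lambda>t n. I n t)"
    using I_hom by (auto simp: bilinear_map_def)
  have eq: "tensor_assoc K L M N = tensor_lift K ?T (\<lambda>t n. I n t)"
    by (simp add: tensor_assoc_def I_def \<beta>_def Let_def)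
  show "tensor_assoc K L M N \<in> module_hom K (tensor K (tensor K L M) N) ?T"
    unfolding eq by (rule tensor_lift_hom[OF LM mods(3) T b])
  assume lmn: "l \<in> carrier L" "m \<in> carrier M" "n \<in> carrier N"
  show "tensor_assoc K L M N (pure_tensor K (tensor K L M) N (pure_tensor K L M l m) n)
      = pure_tensor K L (tensor K M N) l (pure_tensor K M N m n)"
    unfolding eq using lmn
    by (subst tensor_lift_pure[OF LM mods(3) T b])
       (simp_all add: pure_tensor_closed[OF mods(1,2)] I_pure \<beta>_def)
qed

section \<open>Tensor products of subspaces\<close>

lemma submodule_inclusion:
  assumes "submodule K N M"
  shows "(\<lambda>v. v) \<in> module_hom K (M\<lparr>carrier := N\<rparr>) M"
  using submodule.subset[OF assms] by (auto simp: module_hom_def)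

context
  fixes K :: "('k, 'c) ring_scheme" and M :: "('k, 'm, 'd) module_scheme"
    and A :: "('k, 'a, 'e) module_scheme" and N :: "'m set" and X :: "'a set"
  assumes M: "module K M" and A: "module K A" and N: "submodule K N M" and X: "submodule K X A"
begin

private lemma inclusion:
  "module K (M\<lparr>carrier := N\<rparr>)" "module K (A\<lparr>carrier := X\<rparr>)"
  "(\<lambda>m. m) \<in> module_hom K (M\<lparr>carrier := N\<rparr>) M" "(\<lambda>a. a) \<in> module_hom K (A\<lparr>carrier := X\<rparr>) A"
  using M A N X by (simp_all add: submodule_inclusion module.submodule_is_module)

private lemmas incl_hom = tensor_map_hom[OF inclusion(1,2) M A inclusion(3,4)]
private lemmas incl_pure = tensor_map_pure[OF inclusion(1,2) M A inclusion(3,4)]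

lemma tensor_sub_submodule: "submodule K (tensor_sub K M A N X) (tensor K M A)"
  unfolding tensor_sub_def
  by (rule submodule_image[OF tensor_module tensor_module incl_hom submodule_carrier[OF tensor_module]])
     (intro inclusion M A)+

lemma pure_tensor_sub:
  assumes "n \<in> N" "x \<in> X"
  shows "pure_tensor K M A n x \<in> tensor_sub K M A N X"
proof -
  have "pure_tensor K (M\<lparr>carrier := N\<rparr>) (A\<lparr>carrier := X\<rparr>) n x
      \<in> carrier (tensor K (M\<lparr>carrier := N\<rparr>) (A\<lparr>carrier := X\<rparr>))"
    using assms by (intro pure_tensor_closed inclusion) auto
  moreover have "tensor_map K M A (\<lambda>m. m) (\<lambda>a. a)
      (pure_tensor K (M\<lparr>carrier := N\<rparr>) (A\<lparr>carrier := X\<rparr>) n x) = pure_tensor K M A n x"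
    using assms by (intro incl_pure) auto
  ultimately show ?thesis unfolding tensor_sub_def by (metis imageI)
qed

text \<open>
  With the two preceding lemmas this identifies \<open>N \<otimes> X\<close>, defined as the image of a tensor product of
  restricted modules, with the smallest submodule of \<open>M \<otimes> A\<close> containing the pure tensors \<open>n \<otimes> x\<close>.
\<close>

lemma tensor_sub_least:
  assumes "submodule K W (tensor K M A)"
    and "\<And>n x. n \<in> N \<Longrightarrow> x \<in> X \<Longrightarrow> pure_tensor K M A n x \<in> W"
  shows "tensor_sub K M A N X \<subseteq> W"
proof -
  let ?T = "tensor K (M\<lparr>carrier := N\<rparr>) (A\<lparr>carrier := X\<rparr>)"
  have "carrier ?T \<subseteq> {t \<in> carrier ?T. tensor_map K M A (\<lambda>m. m) (\<lambda>a. a) t \<in> W}"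
    using assms incl_pure pure_tensor_closed[OF inclusion(1,2)]
    by (intro tensor_generated submodule_preimage[OF _ _ incl_hom] tensor_module inclusion M A) auto
  then show ?thesis by (auto simp: tensor_sub_def)
qed

end

lemma tensor_sub_carrier:
  assumes "module K M" "module K A"
  shows "tensor_sub K M A (carrier M) (carrier A) = carrier (tensor K M A)"
proof
  note * = submodule_carrier[OF assms(1)] submodule_carrier[OF assms(2)]
  show "tensor_sub K M A (carrier M) (carrier A) \<subseteq> carrier (tensor K M A)"
    by (rule submodule.subset[OF tensor_sub_submodule[OF assms *]])
  show "carrier (tensor K M A) \<subseteq> tensor_sub K M A (carrier M) (carrier A)"
    by (intro tensor_generated assms tensor_sub_submodule pure_tensor_sub *)
qed

lemma tensor_map_tensor_sub:
  assumes "module K M" "module K A" "submodule K N M" "submodule K X A"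
    and "module K M'" "module K A'" "submodule K N' M'" "submodule K X' A'"
    and "f \<in> module_hom K M M'" "g \<in> module_hom K A A'" "f ` N \<subseteq> N'" "g ` X \<subseteq> X'"
    and "t \<in> tensor_sub K M A N X"
  shows "tensor_map K M' A' f g t \<in> tensor_sub K M' A' N' X'"
proof -
  have c: "n \<in> carrier M" "x \<in> carrier A" if "n \<in> N" "x \<in> X" for n x
    using that submodule.subset[OF assms(3)] submodule.subset[OF assms(4)] by auto
  have "tensor_sub K M A N X
      \<subseteq> {t \<in> carrier (tensor K M A). tensor_map K M' A' f g t \<in> tensor_sub K M' A' N' X'}"
  proof (rule tensor_sub_least[OF assms(1-4) submodule_preimage[OF tensor_module[OF assms(1,2)]
          tensor_module[OF assms(5,6)] tensor_map_hom[OF assms(1,2,5,6,9,10)]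
          tensor_sub_submodule[OF assms(5-8)]]])
    fix n x assume nx: "n \<in> N" "x \<in> X"
    then have "pure_tensor K M' A' (f n) (g x) \<in> tensor_sub K M' A' N' X'"
      using assms by (intro pure_tensor_sub) auto
    then show "pure_tensor K M A n x
        \<in> {t \<in> carrier (tensor K M A). tensor_map K M' A' f g t \<in> tensor_sub K M' A' N' X'}"
      using nx c by (simp add: tensor_map_pure[OF assms(1,2,5,6,9,10)] pure_tensor_closed assms)
  qed
  then show ?thesis using assms(13) by blast
qed

lemma tensor_sub_mono:
  assumes "module K M" "module K A" "submodule K N M" "submodule K X A"
    and "submodule K N' M" "submodule K X' A" "N \<subseteq> N'" "X \<subseteq> X'"
  shows "tensor_sub K M A N X \<subseteq> tensor_sub K M A N' X'"
  using assms by (intro tensor_sub_least tensor_sub_submodule pure_tensor_sub) auto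

text \<open>
  A pure tensor \<open>n \<otimes> x\<close> involves a single element of the union, and the right-hand side is a submodule
  because the family is directed.
\<close>

lemma tensor_sub_directed_union:
  assumes "module K M" "module K A" "submodule K N M" "I \<noteq> {}"
    and X: "\<And>i. i \<in> I \<Longrightarrow> submodule K (X i) A"
    and dir: "\<And>i j. i \<in> I \<Longrightarrow> j \<in> I \<Longrightarrow> \<exists>k\<in>I. X i \<subseteq> X k \<and> X j \<subseteq> X k"
  shows "tensor_sub K M A N (\<Union>i\<in>I. X i) = (\<Union>i\<in>I. tensor_sub K M A N (X i))"
proof
  have U: "submodule K (\<Union>i\<in>I. X i) A"
    using dir by (intro module.nested_union_vs[OF assms(2) X _ refl assms(4)]) (simp_all add: Bex_def)
  have dirT: "\<exists>k. k \<in> I \<and> tensor_sub K M A N (X i) \<subseteq> tensor_sub K M A N (X k)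
      \<and> tensor_sub K M A N (X j) \<subseteq> tensor_sub K M A N (X k)" if "i \<in> I" "j \<in> I" for i j
    using dir[OF that] that tensor_sub_mono[OF assms(1-3) X assms(3) X] by blast
  have "submodule K (\<Union>i\<in>I. tensor_sub K M A N (X i)) (tensor K M A)"
    by (rule module.nested_union_vs[OF tensor_module[OF assms(1,2)]
          tensor_sub_submodule[OF assms(1-3) X] dirT refl assms(4)])
  then show "tensor_sub K M A N (\<Union>i\<in>I. X i) \<subseteq> (\<Union>i\<in>I. tensor_sub K M A N (X i))"
    using pure_tensor_sub[OF assms(1-3) X] by (intro tensor_sub_least[OF assms(1-3) U]) auto
  show "(\<Union>i\<in>I. tensor_sub K M A N (X i)) \<subseteq> tensor_sub K M A N (\<Union>i\<in>I. X i)"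
    using tensor_sub_mono[OF assms(1-3) X assms(3) U] by blast
qed

section \<open>Contraction by linear functionals\<close>

text \<open>
  A field, given as a ring record, has no scalar multiplication, so a functional cannot be taken as an
  element of some \<open>module_hom K V K\<close>.
\<close>

definition linear_functional ::
    "('k, 'c) ring_scheme \<Rightarrow> ('k, 'v, 'd) module_scheme \<Rightarrow> ('v \<Rightarrow> 'k) \<Rightarrow> bool" where
  "linear_functional K V \<phi> \<longleftrightarrow> \<phi> \<in> carrier V \<rightarrow> carrier K \<and>
    (\<forall>u\<in>carrier V. \<forall>v\<in>carrier V. \<phi> (u \<oplus>\<^bsub>V\<^esub> v) = \<phi> u \<oplus>\<^bsub>K\<^esub> \<phi> v) \<and>
    (\<forall>c\<in>carrier K. \<forall>v\<in>carrier V. \<phi> (c \<odot>\<^bsub>V\<^esub> v) = c \<otimes>\<^bsub>K\<^esub> \<phi> v)"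

lemma linear_functionalD:
  assumes "linear_functional K V \<phi>"
  shows "v \<in> carrier V \<Longrightarrow> \<phi> v \<in> carrier K"
    and "u \<in> carrier V \<Longrightarrow> v \<in> carrier V \<Longrightarrow> \<phi> (u \<oplus>\<^bsub>V\<^esub> v) = \<phi> u \<oplus>\<^bsub>K\<^esub> \<phi> v"
    and "c \<in> carrier K \<Longrightarrow> v \<in> carrier V \<Longrightarrow> \<phi> (c \<odot>\<^bsub>V\<^esub> v) = c \<otimes>\<^bsub>K\<^esub> \<phi> v"
  using assms by (auto simp: linear_functional_def)

lemma linear_functional_comp:
  assumes "linear_functional K W \<phi>" "f \<in> module_hom K V W"
  shows "linear_functional K V (\<lambda>v. \<phi> (f v))"
  unfolding linear_functional_def
  using linear_functionalD[OF assms(1)] module_hom_apply[OF assms(2)]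
    module_hom_add[OF assms(2)] module_hom_smult[OF assms(2)] by simp

lemma maximal_submodule_avoiding:
  assumes "module K V" "submodule K U V" "b \<notin> U"
  obtains W where "submodule K W V" "U \<subseteq> W" "b \<notin> W"
    "\<And>W'. submodule K W' V \<Longrightarrow> W \<subseteq> W' \<Longrightarrow> b \<notin> W' \<Longrightarrow> W' = W"
proof -
  define \<F> where "\<F> = {W. submodule K W V \<and> U \<subseteq> W \<and> b \<notin> W}"
  have "\<exists>W\<in>\<F>. \<forall>W'\<in>\<F>. W \<subseteq> W' \<longrightarrow> W' = W"
  proof (rule subset_Zorn_nonempty)
    show "\<F> \<noteq> {}" using assms unfolding \<F>_def by blast
    fix \<C> assume \<C>: "\<C> \<noteq> {}" "subset.chain \<F> \<C>"
    have chain: "W \<subseteq> W' \<or> W' \<subseteq> W" if "W \<in> \<C>" "W' \<in> \<C>" for W W'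
      using \<C>(2) that by (simp add: subset_chain_def)
    have sub: "\<C> \<subseteq> \<F>" using \<C>(2) by (simp add: subset_chain_def)
    have mem: "submodule K W V" "U \<subseteq> W" "b \<notin> W" if "W \<in> \<C>" for W
      using subsetD[OF sub that] by (simp_all add: \<F>_def)
    have "submodule K (\<Union>W\<in>\<C>. W) V"
    proof (rule module.nested_union_vs[OF assms(1) mem(1) _ refl \<C>(1)])
      fix W W' assume "W \<in> \<C>" "W' \<in> \<C>"
      with chain[OF this] show "\<exists>Z. Z \<in> \<C> \<and> W \<subseteq> Z \<and> W' \<subseteq> Z" by (metis subset_refl)
    qed
    moreover have "U \<subseteq> \<Union>\<C>" "b \<notin> \<Union>\<C>" using \<C>(1) mem by blast+
    ultimately show "\<Union>\<C> \<in> \<F>" by (simp add: \<F>_def)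
  qed
  then obtain W where W: "W \<in> \<F>" "\<forall>W'\<in>\<F>. W \<subseteq> W' \<longrightarrow> W' = W" by (rule bexE)
  show thesis
  proof (rule that)
    show "submodule K W V" "U \<subseteq> W" "b \<notin> W" using W(1) by (simp_all add: \<F>_def)
    show "W' = W" if W': "submodule K W' V" "W \<subseteq> W'" "b \<notin> W'" for W'
    proof -
      have "U \<subseteq> W'" using W(1) W'(2) unfolding \<F>_def by blast
      then show ?thesis using W(2) W' by (simp add: \<F>_def)
    qed
  qed
qed

lemma submodule_sum_line:
  assumes "module K V" "submodule K W V" "b \<in> carrier V"
  shows "submodule K {w \<oplus>\<^bsub>V\<^esub> c \<odot>\<^bsub>V\<^esub> b | w c. w \<in> W \<and> c \<in> carrier K} V" (is "submodule K ?S V")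
proof -
  interpret V: module K V by fact
  interpret W: submodule K W V by fact
  have W: "w \<in> carrier V" if "w \<in> W" for w using W.subset that by blast
  show ?thesis
  proof (rule submoduleI[OF assms(1)])
    show "?S \<subseteq> carrier V" using W assms(3) by auto
    have "\<zero>\<^bsub>V\<^esub> = \<zero>\<^bsub>V\<^esub> \<oplus>\<^bsub>V\<^esub> \<zero>\<^bsub>K\<^esub> \<odot>\<^bsub>V\<^esub> b" using assms(3) by simp
    then show "\<zero>\<^bsub>V\<^esub> \<in> ?S" using W.zero_closed by blast
  next
    fix v v' assume "v \<in> ?S" "v' \<in> ?S"
    then obtain u c u' c' where *: "u \<in> W" "c \<in> carrier K" "v = u \<oplus>\<^bsub>V\<^esub> c \<odot>\<^bsub>V\<^esub> b"
      "u' \<in> W" "c' \<in> carrier K" "v' = u' \<oplus>\<^bsub>V\<^esub> c' \<odot>\<^bsub>V\<^esub> b" by blast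
    have "v \<oplus>\<^bsub>V\<^esub> v' = (u \<oplus>\<^bsub>V\<^esub> u') \<oplus>\<^bsub>V\<^esub> (c \<oplus>\<^bsub>K\<^esub> c') \<odot>\<^bsub>V\<^esub> b"
      using * W assms(3) by (simp add: V.smult_l_distr V.M.a_ac)
    then show "v \<oplus>\<^bsub>V\<^esub> v' \<in> ?S" using * by blast
  next
    fix d v assume d: "d \<in> carrier K" and "v \<in> ?S"
    then obtain u c where *: "u \<in> W" "c \<in> carrier K" "v = u \<oplus>\<^bsub>V\<^esub> c \<odot>\<^bsub>V\<^esub> b" by blast
    have "d \<odot>\<^bsub>V\<^esub> v = d \<odot>\<^bsub>V\<^esub> u \<oplus>\<^bsub>V\<^esub> (d \<otimes>\<^bsub>K\<^esub> c) \<odot>\<^bsub>V\<^esub> b"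
      using * W assms(3) d by (simp add: V.smult_r_distr V.smult_assoc1)
    then show "d \<odot>\<^bsub>V\<^esub> v \<in> ?S" using * d by blast
  qed
qed

text \<open>
  If \<open>W \<supseteq> U\<close> is maximal among the subspaces that avoid \<open>b\<close>, then \<open>V = W \<oplus> K b\<close>: for \<open>v \<notin> W\<close> the space
  \<open>W + K v\<close> contains \<open>b\<close> by maximality, and the equation for \<open>b\<close> can be solved for \<open>v\<close>.  The functional
  is the coordinate along \<open>b\<close>.
\<close>

lemma separating_functional:
  assumes "vectorspace K V" "submodule K U V" "b \<in> carrier V" "b \<notin> U"
  shows "\<exists>\<phi>. linear_functional K V \<phi> \<and> \<phi> b = \<one>\<^bsub>K\<^esub> \<and> (\<forall>u\<in>U. \<phi> u = \<zero>\<^bsub>K\<^esub>)"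
proof -
  interpret vectorspace K V by fact
  obtain W where W: "submodule K W V" "U \<subseteq> W" "b \<notin> W"
    and max: "\<And>W'. submodule K W' V \<Longrightarrow> W \<subseteq> W' \<Longrightarrow> b \<notin> W' \<Longrightarrow> W' = W"
    using maximal_submodule_avoiding[OF module_axioms assms(2,4)] by metis
  interpret W: submodule K W V by fact
  have Wc: "w \<in> carrier V" if "w \<in> W" for w using W.subset that by blast
  have W_scale: "v \<in> W" if "c \<odot>\<^bsub>V\<^esub> v \<in> W" "c \<in> carrier K" "c \<noteq> \<zero>\<^bsub>K\<^esub>" "v \<in> carrier V" for c v
    using mult_inverse[OF that(2,4) refl that(3)] that
    by (metis W.smult_closed inverse_exists)
  have W_minus: "\<ominus>\<^bsub>V\<^esub> w \<in> W" if "w \<in> W" for w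
    using W.smult_closed[of "\<ominus>\<^bsub>K\<^esub> \<one>\<^bsub>K\<^esub>" w] that Wc[OF that] smult_minus_1[of w] by simp
  have ex: "\<exists>c\<in>carrier K. \<exists>w\<in>W. v = w \<oplus>\<^bsub>V\<^esub> c \<odot>\<^bsub>V\<^esub> b" if v: "v \<in> carrier V" for v
  proof (cases "v \<in> W")
    case True
    then have "v = v \<oplus>\<^bsub>V\<^esub> \<zero>\<^bsub>K\<^esub> \<odot>\<^bsub>V\<^esub> b" using v assms(3) by simp
    then show ?thesis using True by blast
  next
    case False
    let ?W' = "{w \<oplus>\<^bsub>V\<^esub> c \<odot>\<^bsub>V\<^esub> v | w c. w \<in> W \<and> c \<in> carrier K}"
    have sub: "submodule K ?W' V" by (rule submodule_sum_line[OF module_axioms W(1) v])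
    have "W \<subseteq> ?W'"
    proof
      fix w assume "w \<in> W"
      moreover have "w = w \<oplus>\<^bsub>V\<^esub> \<zero>\<^bsub>K\<^esub> \<odot>\<^bsub>V\<^esub> v" using v Wc[OF \<open>w \<in> W\<close>] by simp
      ultimately show "w \<in> ?W'" by blast
    qed
    moreover have "v \<in> ?W'"
    proof -
      have "v = \<zero>\<^bsub>V\<^esub> \<oplus>\<^bsub>V\<^esub> \<one>\<^bsub>K\<^esub> \<odot>\<^bsub>V\<^esub> v" using v by simp
      then show ?thesis using W.zero_closed by blast
    qed
    ultimately have "b \<in> ?W'" using max[OF sub] False by blast
    then obtain w c where wc: "w \<in> W" "c \<in> carrier K" "b = w \<oplus>\<^bsub>V\<^esub> c \<odot>\<^bsub>V\<^esub> v" by blast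
    have c0: "c \<noteq> \<zero>\<^bsub>K\<^esub>" using wc W(3) v Wc by auto
    have ic: "inv\<^bsub>K\<^esub> c \<in> carrier K" using wc c0 by simp
    have "c \<odot>\<^bsub>V\<^esub> v = \<ominus>\<^bsub>V\<^esub> w \<oplus>\<^bsub>V\<^esub> b"
      using wc v Wc[OF wc(1)] by (simp add: M.r_neg1)
    then have "v = inv\<^bsub>K\<^esub> c \<odot>\<^bsub>V\<^esub> (\<ominus>\<^bsub>V\<^esub> w \<oplus>\<^bsub>V\<^esub> b)"
      by (rule mult_inverse[OF wc(2) v _ c0])
    then have "v = inv\<^bsub>K\<^esub> c \<odot>\<^bsub>V\<^esub> (\<ominus>\<^bsub>V\<^esub> w) \<oplus>\<^bsub>V\<^esub> inv\<^bsub>K\<^esub> c \<odot>\<^bsub>V\<^esub> b"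
      using Wc[OF wc(1)] ic assms(3) by (simp add: smult_r_distr)
    then show ?thesis using ic W.smult_closed[OF ic W_minus[OF wc(1)]] by blast
  qed
  have uniq: "c = c'"
    if "w \<oplus>\<^bsub>V\<^esub> c \<odot>\<^bsub>V\<^esub> b = w' \<oplus>\<^bsub>V\<^esub> c' \<odot>\<^bsub>V\<^esub> b" "w \<in> W" "w' \<in> W" "c \<in> carrier K" "c' \<in> carrier K"
    for w w' c c'
  proof (rule ccontr)
    assume ne: "c \<noteq> c'"
    have wc: "w \<in> carrier V" "w' \<in> carrier V" using that Wc by auto
    have d: "c \<ominus>\<^bsub>K\<^esub> c' \<in> carrier K" "c \<ominus>\<^bsub>K\<^esub> c' \<noteq> \<zero>\<^bsub>K\<^esub>" using that ne by auto
    have "c \<odot>\<^bsub>V\<^esub> b = \<ominus>\<^bsub>V\<^esub> w \<oplus>\<^bsub>V\<^esub> (w \<oplus>\<^bsub>V\<^esub> c \<odot>\<^bsub>V\<^esub> b)" using wc that(4) assms(3) by (simp add: M.r_neg1)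
    also have "\<dots> = (w' \<oplus>\<^bsub>V\<^esub> \<ominus>\<^bsub>V\<^esub> w) \<oplus>\<^bsub>V\<^esub> c' \<odot>\<^bsub>V\<^esub> b"
      unfolding that(1) using wc that(4,5) assms(3) by (simp add: M.a_ac)
    finally have "(c \<ominus>\<^bsub>K\<^esub> c') \<odot>\<^bsub>V\<^esub> b = ((w' \<oplus>\<^bsub>V\<^esub> \<ominus>\<^bsub>V\<^esub> w) \<oplus>\<^bsub>V\<^esub> c' \<odot>\<^bsub>V\<^esub> b) \<oplus>\<^bsub>V\<^esub> \<ominus>\<^bsub>V\<^esub> (c' \<odot>\<^bsub>V\<^esub> b)"
      using wc that(4,5) assms(3) by (simp add: smult_l_distr smult_l_minus R.minus_eq)
    also have "\<dots> = w' \<oplus>\<^bsub>V\<^esub> \<ominus>\<^bsub>V\<^esub> w" using wc that(4,5) assms(3) by (simp add: M.a_assoc M.r_neg)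
    also have "\<dots> \<in> W" using that W_minus by simp
    finally show False using W_scale[OF _ d assms(3)] W(3) by blast
  qed
  define \<phi> where "\<phi> v = (SOME c. c \<in> carrier K \<and> (\<exists>w\<in>W. v = w \<oplus>\<^bsub>V\<^esub> c \<odot>\<^bsub>V\<^esub> b))" for v
  have \<phi>: "\<phi> v \<in> carrier K \<and> (\<exists>w\<in>W. v = w \<oplus>\<^bsub>V\<^esub> \<phi> v \<odot>\<^bsub>V\<^esub> b)" if "v \<in> carrier V" for v
    unfolding \<phi>_def by (rule someI_ex) (use ex[OF that] in blast)
  have \<phi>_eq: "\<phi> (w \<oplus>\<^bsub>V\<^esub> c \<odot>\<^bsub>V\<^esub> b) = c" if wc: "w \<in> W" "c \<in> carrier K" for w c
  proof -
    have "w \<oplus>\<^bsub>V\<^esub> c \<odot>\<^bsub>V\<^esub> b \<in> carrier V" using wc Wc assms(3) by simp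
    from \<phi>[OF this] obtain w' where "w' \<in> W" "\<phi> (w \<oplus>\<^bsub>V\<^esub> c \<odot>\<^bsub>V\<^esub> b) \<in> carrier K"
      "w \<oplus>\<^bsub>V\<^esub> c \<odot>\<^bsub>V\<^esub> b = w' \<oplus>\<^bsub>V\<^esub> \<phi> (w \<oplus>\<^bsub>V\<^esub> c \<odot>\<^bsub>V\<^esub> b) \<odot>\<^bsub>V\<^esub> b" by blast
    then show ?thesis using uniq[of w c w' "\<phi> (w \<oplus>\<^bsub>V\<^esub> c \<odot>\<^bsub>V\<^esub> b)"] wc by simp
  qed
  have "\<phi> (u \<oplus>\<^bsub>V\<^esub> v) = \<phi> u \<oplus>\<^bsub>K\<^esub> \<phi> v" if uv: "u \<in> carrier V" "v \<in> carrier V" for u v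
  proof -
    obtain w where w: "w \<in> W" "u = w \<oplus>\<^bsub>V\<^esub> \<phi> u \<odot>\<^bsub>V\<^esub> b" "\<phi> u \<in> carrier K" using \<phi>[OF uv(1)] by blast
    obtain w' where w': "w' \<in> W" "v = w' \<oplus>\<^bsub>V\<^esub> \<phi> v \<odot>\<^bsub>V\<^esub> b" "\<phi> v \<in> carrier K" using \<phi>[OF uv(2)] by blast
    have "u \<oplus>\<^bsub>V\<^esub> v = (w \<oplus>\<^bsub>V\<^esub> \<phi> u \<odot>\<^bsub>V\<^esub> b) \<oplus>\<^bsub>V\<^esub> (w' \<oplus>\<^bsub>V\<^esub> \<phi> v \<odot>\<^bsub>V\<^esub> b)"
      using w(2) w'(2) by simp
    also have "\<dots> = (w \<oplus>\<^bsub>V\<^esub> w') \<oplus>\<^bsub>V\<^esub> (\<phi> u \<oplus>\<^bsub>K\<^esub> \<phi> v) \<odot>\<^bsub>V\<^esub> b"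
      using w(1,3) w'(1,3) Wc assms(3) by (simp add: smult_l_distr M.a_ac)
    finally show ?thesis using \<phi>_eq w w' by simp
  qed
  moreover have "\<phi> (c \<odot>\<^bsub>V\<^esub> v) = c \<otimes>\<^bsub>K\<^esub> \<phi> v" if cv: "c \<in> carrier K" "v \<in> carrier V" for c v
  proof -
    obtain w where w: "w \<in> W" "v = w \<oplus>\<^bsub>V\<^esub> \<phi> v \<odot>\<^bsub>V\<^esub> b" "\<phi> v \<in> carrier K" using \<phi>[OF cv(2)] by blast
    have "c \<odot>\<^bsub>V\<^esub> v = c \<odot>\<^bsub>V\<^esub> (w \<oplus>\<^bsub>V\<^esub> \<phi> v \<odot>\<^bsub>V\<^esub> b)" using w(2) by simp
    also have "\<dots> = c \<odot>\<^bsub>V\<^esub> w \<oplus>\<^bsub>V\<^esub> (c \<otimes>\<^bsub>K\<^esub> \<phi> v) \<odot>\<^bsub>V\<^esub> b"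
      using w(1,3) cv(1) Wc assms(3) by (simp add: smult_r_distr smult_assoc1)
    finally show ?thesis using \<phi>_eq w cv by simp
  qed
  moreover have "\<phi> b = \<one>\<^bsub>K\<^esub>" using \<phi>_eq[of "\<zero>\<^bsub>V\<^esub>" "\<one>\<^bsub>K\<^esub>"] assms(3) by simp
  moreover have "\<phi> u = \<zero>\<^bsub>K\<^esub>" if "u \<in> U" for u
    using \<phi>_eq[of u "\<zero>\<^bsub>K\<^esub>"] that W(2) Wc assms(3) by auto
  ultimately show ?thesis using \<phi> by (intro exI[of _ \<phi>]) (simp add: linear_functional_def)
qed

text \<open>
  The contraction \<open>id \<otimes> \<phi> : M \<otimes> A \<rightarrow> M \<otimes> K = M\<close>.
\<close>

definition contract ::
    "('k, 'c) ring_scheme \<Rightarrow> ('k, 'm, 'd) module_scheme \<Rightarrow> ('a \<Rightarrow> 'k)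
      \<Rightarrow> ('m \<times> 'a \<Rightarrow> 'k) set \<Rightarrow> 'm" where
  "contract K M \<phi> = tensor_lift K M (\<lambda>m a. \<phi> a \<odot>\<^bsub>M\<^esub> m)"

lemma contract:
  assumes "module K M" "module K A" "linear_functional K A \<phi>"
  shows contract_hom: "contract K M \<phi> \<in> module_hom K (tensor K M A) M"
    and contract_pure: "m \<in> carrier M \<Longrightarrow> a \<in> carrier A \<Longrightarrow>
      contract K M \<phi> (pure_tensor K M A m a) = \<phi> a \<odot>\<^bsub>M\<^esub> m"
proof -
  interpret M: module K M by fact
  have b: "bilinear_map K M A M (\<lambda>m a. \<phi> a \<odot>\<^bsub>M\<^esub> m)"
    using linear_functionalD[OF assms(3)]
    unfolding bilinear_map_def module_hom_def
    by (auto simp: M.smult_l_distr M.smult_r_distr M.smult_assoc1[symmetric] M.R.m_comm)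
  show "contract K M \<phi> \<in> module_hom K (tensor K M A) M"
    unfolding contract_def by (rule tensor_lift_hom[OF assms(1,2,1) b])
  show "m \<in> carrier M \<Longrightarrow> a \<in> carrier A \<Longrightarrow>
      contract K M \<phi> (pure_tensor K M A m a) = \<phi> a \<odot>\<^bsub>M\<^esub> m"
    unfolding contract_def by (rule tensor_lift_pure[OF assms(1,2,1) b])
qed

lemma contract_tensor_sub:
  assumes "module K M" "module K A" "linear_functional K A \<phi>"
    and "submodule K N M" "submodule K X A" "t \<in> tensor_sub K M A N X"
  shows "contract K M \<phi> t \<in> N"
proof -
  have c: "n \<in> carrier M" "x \<in> carrier A" if "n \<in> N" "x \<in> X" for n x
    using that submodule.subset[OF assms(4)] submodule.subset[OF assms(5)] by auto
  have "tensor_sub K M A N X \<subseteq> {t \<in> carrier (tensor K M A). contract K M \<phi> t \<in> N}"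
    using c assms(4) linear_functionalD(1)[OF assms(3)]
    by (intro tensor_sub_least[OF assms(1,2,4,5)]
        submodule_preimage[OF tensor_module[OF assms(1,2)] assms(1) contract_hom[OF assms(1-3)] assms(4)])
       (simp add: contract_pure[OF assms(1-3)] pure_tensor_closed[OF assms(1,2)] submodule.smult_closed)
  then show ?thesis using assms(6) by blast
qed

lemma contract_natural:
  assumes "module K M" "module K N" "module K A" "linear_functional K A \<phi>"
    and "f \<in> module_hom K M N" "t \<in> carrier (tensor K M A)"
  shows "contract K N \<phi> (tensor_map K N A f (\<lambda>a. a) t) = f (contract K M \<phi> t)"
proof -
  note id = identity_module_hom[OF assms(3)]
  show ?thesis
  proof (rule tensor_hom_eqI[OF assms(1,3,2) _ _ _ assms(6)])
    show "(\<lambda>t. contract K N \<phi> (tensor_map K N A f (\<lambda>a. a) t)) \<in> module_hom K (tensor K M A) N"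
      by (rule module_hom_comp[OF tensor_map_hom[OF assms(1,3,2,3,5) id] contract_hom[OF assms(2-4)]])
    show "(\<lambda>t. f (contract K M \<phi> t)) \<in> module_hom K (tensor K M A) N"
      by (rule module_hom_comp[OF contract_hom[OF assms(1,3,4)] assms(5)])
    fix m a assume "m \<in> carrier M" "a \<in> carrier A"
    then show "contract K N \<phi> (tensor_map K N A f (\<lambda>a. a) (pure_tensor K M A m a))
        = f (contract K M \<phi> (pure_tensor K M A m a))"
      using assms(5) linear_functionalD(1)[OF assms(4)]
      by (simp add: tensor_map_pure[OF assms(1,3,2,3,5) id] contract_pure[OF assms(1,3,4)]
          contract_pure[OF assms(2-4)] module_hom_apply module_hom_smult)
  qed
qed

text \<open>
  Contracting the last of three factors does not depend on the bracketing.
\<close>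

lemma contract_assoc:
  assumes mods: "module K L" "module K M" "module K N" and \<phi>: "linear_functional K N \<phi>"
    and t: "t \<in> carrier (tensor K (tensor K L M) N)"
  shows "tensor_map K L M (\<lambda>l. l) (contract K M \<phi>) (tensor_assoc K L M N t)
    = contract K (tensor K L M) \<phi> t"
proof -
  note LM = tensor_module[OF mods(1,2)] and MN = tensor_module[OF mods(2,3)]
  note id = identity_module_hom[OF mods(1)] and c = contract_hom[OF mods(2,3) \<phi>]
  note hom = module_hom_comp[OF tensor_assoc_hom[OF mods] tensor_map_hom[OF mods(1) MN mods(1,2) id c]]
  show ?thesis
  proof (rule tensor_hom_eqI[OF LM mods(3) LM hom contract_hom[OF LM mods(3) \<phi>] _ t])
    fix s n assume s: "s \<in> carrier (tensor K L M)" and n: "n \<in> carrier N"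
    have \<phi>n: "\<phi> n \<in> carrier K" using linear_functionalD(1)[OF \<phi> n] .
    have "tensor_map K L M (\<lambda>l. l) (contract K M \<phi>)
        (tensor_assoc K L M N (pure_tensor K (tensor K L M) N s n)) = \<phi> n \<odot>\<^bsub>tensor K L M\<^esub> s"
    proof (rule tensor_hom_eqI[OF mods(1,2) LM _ _ _ s])
      show "(\<lambda>s. tensor_map K L M (\<lambda>l. l) (contract K M \<phi>)
          (tensor_assoc K L M N (pure_tensor K (tensor K L M) N s n)))
          \<in> module_hom K (tensor K L M) (tensor K L M)"
        by (rule module_hom_comp[OF pure_tensor_hom_left[OF LM mods(3) n] hom])
      show "(\<lambda>s. \<phi> n \<odot>\<^bsub>tensor K L M\<^esub> s) \<in> module_hom K (tensor K L M) (tensor K L M)"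
        by (rule module_hom_smult_const[OF LM LM identity_module_hom[OF LM] \<phi>n])
      fix l m assume lm: "l \<in> carrier L" "m \<in> carrier M"
      show "tensor_map K L M (\<lambda>l. l) (contract K M \<phi>)
          (tensor_assoc K L M N (pure_tensor K (tensor K L M) N (pure_tensor K L M l m) n))
          = \<phi> n \<odot>\<^bsub>tensor K L M\<^esub> pure_tensor K L M l m"
        using lm n \<phi>n module_hom_smult[OF pure_tensor_hom_right[OF mods(1,2) lm(1)] \<phi>n lm(2)]
        by (simp add: tensor_assoc_pure[OF mods] tensor_map_pure[OF mods(1) MN mods(1,2) id c]
            pure_tensor_closed[OF mods(2,3)] contract_pure[OF mods(2,3) \<phi>])
    qed
    then show "tensor_map K L M (\<lambda>l. l) (contract K M \<phi>)
        (tensor_assoc K L M N (pure_tensor K (tensor K L M) N s n))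
        = contract K (tensor K L M) \<phi> (pure_tensor K (tensor K L M) N s n)"
      using s n by (simp add: contract_pure[OF LM mods(3) \<phi>])
  qed
qed

text \<open>
  \<open>A\<close> is the directed union of the spans of its finite subsets.
\<close>

lemma finite_tensor_support:
  assumes "module K M" "module K A" "t \<in> carrier (tensor K M A)"
  obtains B where "finite B" "B \<subseteq> carrier A"
    "t \<in> tensor_sub K M A (carrier M) (module.span K A B)"
proof -
  interpret A: module K A by fact
  let ?I = "{B. finite B \<and> B \<subseteq> carrier A}"
  have sub: "submodule K (A.span B) A" if "B \<in> ?I" for B
    using that by (intro A.span_is_submodule) simp
  have dir: "\<exists>D\<in>?I. A.span B \<subseteq> A.span D \<and> A.span C \<subseteq> A.span D" if "B \<in> ?I" "C \<in> ?I" for B C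
    using that by (intro bexI[of _ "B \<union> C"] conjI A.span_is_monotone) auto
  have "carrier A = (\<Union>B\<in>?I. A.span B)"
  proof
    show "carrier A \<subseteq> (\<Union>B\<in>?I. A.span B)"
    proof
      fix a assume "a \<in> carrier A"
      then show "a \<in> (\<Union>B\<in>?I. A.span B)" using A.in_own_span[of "{a}"] by (intro UN_I[of "{a}"]) auto
    qed
    show "(\<Union>B\<in>?I. A.span B) \<subseteq> carrier A" using submodule.subset[OF sub] by blast
  qed
  then have "t \<in> tensor_sub K M A (carrier M) (\<Union>B\<in>?I. A.span B)"
    using assms by (simp add: tensor_sub_carrier)
  also have "\<dots> = (\<Union>B\<in>?I. tensor_sub K M A (carrier M) (A.span B))"
    by (rule tensor_sub_directed_union[OF assms(1,2) submodule_carrier[OF assms(1)] _ sub dir]) auto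
  finally show thesis using that by blast
qed

text \<open>
  If \<open>\<phi> b = 1\<close>, this is the projection onto the kernel of \<open>\<phi>\<close> along the line \<open>K b\<close>.
\<close>

lemma projection_along:
  assumes "module K V" "linear_functional K V \<phi>" "b \<in> carrier V"
  shows "(\<lambda>v. v \<ominus>\<^bsub>V\<^esub> \<phi> v \<odot>\<^bsub>V\<^esub> b) \<in> module_hom K V V"
proof -
  interpret V: module K V by fact
  note \<phi> = linear_functionalD[OF assms(2)]
  have "(u \<oplus>\<^bsub>V\<^esub> v) \<ominus>\<^bsub>V\<^esub> \<phi> (u \<oplus>\<^bsub>V\<^esub> v) \<odot>\<^bsub>V\<^esub> b = (u \<ominus>\<^bsub>V\<^esub> \<phi> u \<odot>\<^bsub>V\<^esub> b) \<oplus>\<^bsub>V\<^esub> (v \<ominus>\<^bsub>V\<^esub> \<phi> v \<odot>\<^bsub>V\<^esub> b)"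
    if "u \<in> carrier V" "v \<in> carrier V" for u v
    using that \<phi> assms(3) by (simp add: V.smult_l_distr V.M.minus_eq V.M.minus_add V.M.a_ac)
  moreover have "c \<odot>\<^bsub>V\<^esub> v \<ominus>\<^bsub>V\<^esub> \<phi> (c \<odot>\<^bsub>V\<^esub> v) \<odot>\<^bsub>V\<^esub> b = c \<odot>\<^bsub>V\<^esub> (v \<ominus>\<^bsub>V\<^esub> \<phi> v \<odot>\<^bsub>V\<^esub> b)"
    if "c \<in> carrier K" "v \<in> carrier V" for c v
    using that \<phi> assms(3) by (simp add: V.smult_assoc1 V.M.minus_eq V.smult_r_distr V.smult_r_minus)
  ultimately show ?thesis using \<phi>(1) assms(3) by (auto simp: module_hom_def)
qed

text \<open>
  Induction on \<open>B\<close>.  If \<open>b\<close> is independent of \<open>B\<close>, let \<open>\<phi>\<close> vanish on the span of \<open>B\<close> with \<open>\<phi> b = 1\<close>,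
  let \<open>\<pi>\<close> be the projection \<open>a \<mapsto> a - \<phi>(a) b\<close>, and split \<open>t = (id \<otimes> \<pi>) t + x \<otimes> b\<close> with
  \<open>x = (id \<otimes> \<phi>) t\<close>.  The first summand \<open>t'\<close> lives in \<open>M \<otimes> span B\<close>, and its contractions are again
  contractions of \<open>t\<close>, since \<open>(id \<otimes> \<psi>) t' = (id \<otimes> \<psi> \<circ> \<pi>) t\<close>; so the generators that the
  induction hypothesis gives for \<open>t'\<close>, together with \<open>x\<close>, serve for \<open>t\<close>.
\<close>

lemma finite_contractions_generate:
  assumes "vectorspace K A" "module K M" "finite B" "B \<subseteq> carrier A"
    and "t \<in> tensor_sub K M A (carrier M) (module.span K A B)"
  shows "\<exists>C. finite C \<and> C \<subseteq> {contract K M \<phi> t | \<phi>. linear_functional K A \<phi>} \<and>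
    t \<in> tensor_sub K M A (module.span K M C) (carrier A)"
  using assms(3-5)
proof (induction B arbitrary: t rule: finite_induct)
  interpret A: vectorspace K A by fact
  interpret M: module K M by fact
  note M = M.module_axioms and A = A.module_axioms
  note MA = tensor_module[OF M A]
  interpret MA: module K "tensor K M A" by (rule MA)
  note Mc = submodule_carrier[OF M] and Ac = submodule_carrier[OF A]
  case empty
  have "pure_tensor K M A m a = \<zero>\<^bsub>tensor K M A\<^esub>" if "m \<in> carrier M" "a \<in> A.span {}" for m a
    using that module_hom_zero[OF A MA pure_tensor_hom_right[OF M A]] by (simp add: A.span_empty)
  moreover have "submodule K {\<zero>\<^bsub>tensor K M A\<^esub>} (tensor K M A)"
    by (rule submoduleI[OF MA]) simp_all
  ultimately have "tensor_sub K M A (carrier M) (A.span {}) \<subseteq> {\<zero>\<^bsub>tensor K M A\<^esub>}"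
    by (intro tensor_sub_least[OF M A Mc A.span_is_submodule]) auto
  moreover have "\<zero>\<^bsub>tensor K M A\<^esub> \<in> tensor_sub K M A (M.span {}) (carrier A)"
    by (rule submodule.zero_closed[OF tensor_sub_submodule[OF M A M.span_is_submodule Ac]]) simp
  ultimately show ?case using empty.prems by (intro exI[of _ "{}"]) auto
next
  interpret A: vectorspace K A by fact
  interpret M: module K M by fact
  note M = M.module_axioms and A = A.module_axioms
  note MA = tensor_module[OF M A]
  interpret MA: module K "tensor K M A" by (rule MA)
  note Mc = submodule_carrier[OF M] and Ac = submodule_carrier[OF A]
  case (insert b B)
  have B: "B \<subseteq> carrier A" and b: "b \<in> carrier A" using insert.prems by auto
  note SB = A.span_is_submodule[OF B]
  have tc: "t \<in> carrier (tensor K M A)"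
    using insert.prems submodule.subset[OF tensor_sub_submodule[OF M A Mc A.span_is_submodule]] by blast
  show ?case
  proof (cases "b \<in> A.span B")
    case True
    then have "A.span (insert b B) \<subseteq> A.span B"
      using A.in_own_span[OF B] by (intro A.span_is_subset SB) auto
    then have "t \<in> tensor_sub K M A (carrier M) (A.span B)"
      using insert.prems tensor_sub_mono[OF M A Mc A.span_is_submodule Mc SB] by blast
    then show ?thesis using insert.IH B by blast
  next
    case False
    then obtain \<phi> where \<phi>: "linear_functional K A \<phi>" "\<phi> b = \<one>\<^bsub>K\<^esub>"
      and \<phi>0: "\<And>u. u \<in> A.span B \<Longrightarrow> \<phi> u = \<zero>\<^bsub>K\<^esub>"
      using separating_functional[OF assms(1) SB b] by blast
    define \<pi> where "\<pi> a = a \<ominus>\<^bsub>A\<^esub> \<phi> a \<odot>\<^bsub>A\<^esub> b" for a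
    define t' where "t' = tensor_map K M A (\<lambda>m. m) \<pi> t"
    let ?x = "contract K M \<phi> t"
    have \<pi>: "\<pi> \<in> module_hom K A A"
      using projection_along[OF A \<phi>(1) b] by (simp add: \<pi>_def[abs_def])
    note id = identity_module_hom[OF M]
    note map_hom = tensor_map_hom[OF M A M A id \<pi>] and map_pure = tensor_map_pure[OF M A M A id \<pi>]
    have t'c: "t' \<in> carrier (tensor K M A)" unfolding t'_def by (rule module_hom_apply[OF map_hom tc])
    have x: "?x \<in> carrier M" by (rule module_hom_apply[OF contract_hom[OF M A \<phi>(1)] tc])
    have "\<pi> b \<in> A.span B"
      using \<phi>(2) b submodule.zero_closed[OF SB] by (simp add: \<pi>_def A.M.minus_eq A.M.r_neg)
    moreover have "\<pi> a \<in> A.span B" if "a \<in> B" for a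
    proof -
      have "a \<in> A.span B" "a \<in> carrier A" using that B A.in_own_span[OF B] by auto
      moreover have "\<pi> a = a \<ominus>\<^bsub>A\<^esub> \<zero>\<^bsub>A\<^esub>" using \<phi>0[OF calculation(1)] b by (simp add: \<pi>_def)
      moreover have "\<dots> = a" using calculation(2) A.M.r_neg[OF A.M.zero_closed] A.M.a_inv_closed[OF A.M.zero_closed]
        by (simp add: A.M.minus_eq)
      ultimately show ?thesis by simp
    qed
    ultimately have "A.span (insert b B) \<subseteq> {a \<in> carrier A. \<pi> a \<in> A.span B}"
      using insert.prems by (intro A.span_is_subset submodule_preimage[OF A A \<pi> SB]) auto
    then have "t' \<in> tensor_sub K M A (carrier M) (A.span B)"
      unfolding t'_def using insert.prems
      by (intro tensor_map_tensor_sub[OF M A Mc A.span_is_submodule M A Mc SB id \<pi>]) auto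
    from insert.IH[OF B this] obtain C where C: "finite C"
      "C \<subseteq> {contract K M \<psi> t' | \<psi>. linear_functional K A \<psi>}"
      "t' \<in> tensor_sub K M A (M.span C) (carrier A)" by blast
    have "contract K M \<psi> t' = contract K M (\<lambda>a. \<psi> (\<pi> a)) t" if \<psi>: "linear_functional K A \<psi>" for \<psi>
      unfolding t'_def
    proof (rule tensor_hom_eqI[OF M A M module_hom_comp[OF map_hom contract_hom[OF M A \<psi>]]
          contract_hom[OF M A linear_functional_comp[OF \<psi> \<pi>]] _ tc])
      fix m a assume "m \<in> carrier M" "a \<in> carrier A"
      then show "contract K M \<psi> (tensor_map K M A (\<lambda>m. m) \<pi> (pure_tensor K M A m a))
          = contract K M (\<lambda>a. \<psi> (\<pi> a)) (pure_tensor K M A m a)"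
        by (simp add: map_pure contract_pure[OF M A \<psi>] module_hom_apply[OF \<pi>]
            contract_pure[OF M A linear_functional_comp[OF \<psi> \<pi>]])
    qed
    then have C_sub: "insert ?x C \<subseteq> {contract K M \<psi> t | \<psi>. linear_functional K A \<psi>}"
      using C(2) \<phi>(1) linear_functional_comp[OF _ \<pi>] by blast
    also have "\<dots> \<subseteq> carrier M" using module_hom_apply[OF contract_hom[OF M A] tc] by blast
    finally have Cc: "insert ?x C \<subseteq> carrier M" .
    note SC = M.span_is_submodule[OF Cc]
    have t: "t = t' \<oplus>\<^bsub>tensor K M A\<^esub> pure_tensor K M A ?x b"
      unfolding t'_def
    proof (rule tensor_hom_eqI[OF M A MA identity_module_hom[OF MA] module_hom_plus[OF MA MA map_hom
            module_hom_comp[OF contract_hom[OF M A \<phi>(1)] pure_tensor_hom_left[OF M A b]]] _ tc])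
      fix m a assume m: "m \<in> carrier M" and a: "a \<in> carrier A"
      have \<phi>a: "\<phi> a \<in> carrier K" using linear_functionalD(1)[OF \<phi>(1) a] .
      have "pure_tensor K M A (\<phi> a \<odot>\<^bsub>M\<^esub> m) b = pure_tensor K M A m (\<phi> a \<odot>\<^bsub>A\<^esub> b)"
        using module_hom_smult[OF pure_tensor_hom_left[OF M A b] \<phi>a m]
          module_hom_smult[OF pure_tensor_hom_right[OF M A m] \<phi>a b] by simp
      then have "pure_tensor K M A m (\<pi> a) \<oplus>\<^bsub>tensor K M A\<^esub> pure_tensor K M A (\<phi> a \<odot>\<^bsub>M\<^esub> m) b
          = pure_tensor K M A m (\<pi> a \<oplus>\<^bsub>A\<^esub> \<phi> a \<odot>\<^bsub>A\<^esub> b)"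
        using module_hom_add[OF pure_tensor_hom_right[OF M A m] module_hom_apply[OF \<pi> a]] \<phi>a b by simp
      also have "\<pi> a \<oplus>\<^bsub>A\<^esub> \<phi> a \<odot>\<^bsub>A\<^esub> b = a"
        using a b \<phi>a by (simp add: \<pi>_def A.M.minus_eq A.M.a_assoc A.M.l_neg)
      finally show "pure_tensor K M A m a = tensor_map K M A (\<lambda>m. m) \<pi> (pure_tensor K M A m a)
          \<oplus>\<^bsub>tensor K M A\<^esub> pure_tensor K M A (contract K M \<phi> (pure_tensor K M A m a)) b"
        using m a by (simp add: map_pure contract_pure[OF M A \<phi>(1)])
    qed
    have "t' \<in> tensor_sub K M A (M.span (insert ?x C)) (carrier A)"
      using C(3) tensor_sub_mono[OF M A M.span_is_submodule Ac SC Ac] Cc M.span_is_monotone[of C "insert ?x C"]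
      by blast
    moreover have "pure_tensor K M A ?x b \<in> tensor_sub K M A (M.span (insert ?x C)) (carrier A)"
      using M.in_own_span[OF Cc] b by (intro pure_tensor_sub[OF M A SC Ac]) auto
    ultimately have "t \<in> tensor_sub K M A (M.span (insert ?x C)) (carrier A)"
      using submodule.m_closed[OF tensor_sub_submodule[OF M A SC Ac]] t by metis
    then show ?thesis using C(1) C_sub by (intro exI[of _ "insert ?x C"]) simp
  qed
qed

section \<open>Local finiteness of modules\<close>

context group_scheme_module
begin

lemma module_M: "module K M" and module_A: "module K A" and vectorspace_A: "vectorspace K A"
  using vectorspace algebra field
  by (auto simp: vectorspace_def algebra_def)

lemma comult_linear: "\<Delta> \<in> module_hom K A (tensor K A A)"
  using comult_hom by (simp add: algebra_hom_def tensor_algebra_def module_hom_def Let_def)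

lemma counit_functional: "linear_functional K A \<epsilon>"
  using counit_hom counit_scalar
  by (simp add: linear_functional_def ring_hom_closed ring_hom_add)

text \<open>
  By naturality \<open>\<delta> \<circ> (id \<otimes> \<phi>) = (id \<otimes> id \<otimes> \<phi>) \<circ> (\<delta> \<otimes> id)\<close>, and coassociativity turns
  \<open>(\<delta> \<otimes> id) (\<delta> m)\<close> into \<open>(id \<otimes> \<Delta>) (\<delta> m)\<close>, where the \<open>M\<close>-factor is no longer touched and hence
  stays in \<open>N\<close>.
\<close>

lemma contract_coaction_stable:
  assumes "submodule K N M" "m \<in> carrier M" "\<delta> m \<in> tensor_sub K M A N (carrier A)"
    and \<phi>: "linear_functional K A \<phi>"
  shows "\<delta> (contract K M \<phi> (\<delta> m)) \<in> tensor_sub K M A N (carrier A)"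
proof -
  note M = module_M and A = module_A
  note MA = tensor_module[OF M A] and AA = tensor_module[OF A A]
  note Ac = submodule_carrier[OF A] and AAc = submodule_carrier[OF AA]
  note id = identity_module_hom[OF M] and c = contract_hom[OF A A \<phi>]
  have \<delta>m: "\<delta> m \<in> carrier (tensor K M A)" by (rule module_hom_apply[OF coaction_linear assms(2)])
  let ?t = "tensor_map K (tensor K M A) A \<delta> (\<lambda>x. x) (\<delta> m)"
  have t: "?t \<in> carrier (tensor K (tensor K M A) A)"
    by (rule module_hom_apply[OF tensor_map_hom[OF M A MA A coaction_linear identity_module_hom[OF A]] \<delta>m])
  have "\<delta> (contract K M \<phi> (\<delta> m)) = contract K (tensor K M A) \<phi> ?t"
    by (rule contract_natural[OF M MA A \<phi> coaction_linear \<delta>m, symmetric])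
  also have "\<dots> = tensor_map K M A (\<lambda>x. x) (contract K A \<phi>) (tensor_assoc K M A A ?t)"
    by (rule contract_assoc[OF M A A \<phi> t, symmetric])
  also have "\<dots> = tensor_map K M A (\<lambda>x. x) (contract K A \<phi>)
      (tensor_map K M (tensor K A A) (\<lambda>x. x) \<Delta> (\<delta> m))"
    by (simp only: coaction_coassoc[OF assms(2)])
  also have "\<dots> \<in> tensor_sub K M A N (carrier A)"
    using module_hom_apply[OF c] module_hom_apply[OF comult_linear]
    by (intro tensor_map_tensor_sub[OF M AA assms(1) AAc M A assms(1) Ac id c]
        tensor_map_tensor_sub[OF M A assms(1) Ac M AA assms(1) AAc id comult_linear] assms(3)) auto
  finally show ?thesis .
qed

lemma is_submodule_span:
  assumes "C \<subseteq> carrier M" "\<And>c. c \<in> C \<Longrightarrow> \<delta> c \<in> tensor_sub K M A (module.span K M C) (carrier A)"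
  shows "is_submodule K A M \<delta> (module.span K M C)"
proof -
  interpret M: vectorspace K M by (rule vectorspace)
  note SC = M.span_is_submodule[OF assms(1)]
  have "M.span C \<subseteq> {v \<in> carrier M. \<delta> v \<in> tensor_sub K M A (M.span C) (carrier A)}"
    using assms
    by (intro M.span_is_subset submodule_preimage[OF module_M _ coaction_linear] tensor_module
        tensor_sub_submodule module_M module_A SC submodule_carrier) auto
  then show ?thesis
    unfolding is_submodule_def using M.span_is_subspace[OF assms(1)] by blast
qed

text \<open>
  The submodule is generated by finitely many contractions of \<open>\<delta> m\<close>; the contraction by the counit
  is \<open>m\<close> itself.
\<close>

lemma locally_finite:
  assumes m: "m \<in> carrier M"
  obtains C where "finite C" "C \<subseteq> carrier M" "m \<in> module.span K M C"
    "is_submodule K A M \<delta> (module.span K M C)"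
proof -
  interpret M: vectorspace K M by (rule vectorspace)
  have \<delta>m: "\<delta> m \<in> carrier (tensor K M A)" by (rule module_hom_apply[OF coaction_linear m])
  obtain B where "finite B" "B \<subseteq> carrier A" "\<delta> m \<in> tensor_sub K M A (carrier M) (module.span K A B)"
    by (rule finite_tensor_support[OF module_M module_A \<delta>m])
  from finite_contractions_generate[OF vectorspace_A module_M this]
  obtain C where C: "finite C" "C \<subseteq> {contract K M \<phi> (\<delta> m) | \<phi>. linear_functional K A \<phi>}"
    and mC: "\<delta> m \<in> tensor_sub K M A (M.span C) (carrier A)" by blast
  have Cc: "C \<subseteq> carrier M"
    using C(2) module_hom_apply[OF contract_hom[OF module_M module_A] \<delta>m] by blast
  note SC = M.span_is_submodule[OF Cc]
  have "m = contract K M \<epsilon> (\<delta> m)" using coaction_counit[OF m] by (simp add: contract_def)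
  also have "\<dots> \<in> M.span C"
    by (rule contract_tensor_sub[OF module_M module_A counit_functional SC
          submodule_carrier[OF module_A] mC])
  finally have "m \<in> M.span C" .
  moreover have "is_submodule K A M \<delta> (M.span C)"
  proof (rule is_submodule_span[OF Cc])
    fix c assume "c \<in> C"
    then obtain \<phi> where "linear_functional K A \<phi>" "c = contract K M \<phi> (\<delta> m)" using C(2) by blast
    then show "\<delta> c \<in> tensor_sub K M A (M.span C) (carrier A)"
      using contract_coaction_stable[OF SC m mC] by simp
  qed
  ultimately show thesis by (rule that[OF C(1) Cc])
qed

section \<open>The filtration\<close>

lemma is_submodule_carrier: "is_submodule K A M \<delta> (carrier M)"
  using vectorspace module_hom_apply[OF coaction_linear]
  by (auto simp: is_submodule_def subspace_def submodule_carrier[OF module_M]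
      tensor_sub_carrier[OF module_M module_A])

text \<open>
  The images of the finitely many generators lie in a common member of the chain \<open>N \<otimes> X i\<close>, whose union
  is \<open>N \<otimes> A\<close>; the vectors sent into that member form a subspace.
\<close>

lemma finite_span_eventually_comodule:
  assumes X: "ascending_converging K A X"
    and C: "finite C" "C \<subseteq> carrier M" and sub: "is_submodule K A M \<delta> (module.span K M C)"
  shows "\<exists>i\<^sub>0. \<forall>i\<ge>i\<^sub>0. is_comodule_for K A M \<delta> (X i) (module.span K M C)"
proof -
  interpret M: vectorspace K M by (rule vectorspace)
  note M = module_M and A = module_A
  let ?N = "M.span C" and ?T = "\<lambda>i. tensor_sub K M A (M.span C) (X i)"
  have Xs: "submodule K (X i) A" for i
    using X by (simp add: ascending_converging_def subspace_def)
  have XU: "(\<Union>i. X i) = carrier A" using X by (simp add: ascending_converging_def)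
  have Xmono: "X i \<subseteq> X j" if "i \<le> j" for i j
    using X by (intro lift_Suc_mono_le[of X, OF _ that]) (simp add: ascending_converging_def)
  note N = M.span_is_submodule[OF C(2)]
  have T_mono: "?T i \<subseteq> ?T j" if "i \<le> j" for i j
    using Xmono[OF that] by (intro tensor_sub_mono[OF M A N Xs N Xs]) auto
  have dir: "\<exists>k\<in>UNIV. X i \<subseteq> X k \<and> X j \<subseteq> X k" for i j
    using Xmono[of i "max i j"] Xmono[of j "max i j"] by auto
  have union: "tensor_sub K M A ?N (carrier A) = (\<Union>i. ?T i)"
    unfolding XU[symmetric]
    by (rule tensor_sub_directed_union[where I = UNIV and X = X, OF M A N UNIV_not_empty Xs dir])
  have "\<forall>c\<in>C. \<exists>i. \<delta> c \<in> ?T i"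
  proof
    fix c assume "c \<in> C"
    then have "\<delta> c \<in> \<delta> ` ?N" using M.in_own_span[OF C(2)] by blast
    then have "\<delta> c \<in> (\<Union>i. ?T i)" using sub unfolding is_submodule_def union by blast
    then show "\<exists>i. \<delta> c \<in> ?T i" by blast
  qed
  then obtain j where j: "\<And>c. c \<in> C \<Longrightarrow> \<delta> c \<in> ?T (j c)" by metis
  obtain i\<^sub>0 where i\<^sub>0: "\<And>c. c \<in> C \<Longrightarrow> j c \<le> i\<^sub>0"
    using finite_imageI[OF C(1), of j] unfolding finite_nat_set_iff_bounded_le by blast
  have "is_comodule_for K A M \<delta> (X i) ?N" if "i \<ge> i\<^sub>0" for i
  proof -
    have "\<delta> c \<in> ?T i" if "c \<in> C" for c
      using j[OF that] T_mono[OF order_trans[OF i\<^sub>0[OF that] \<open>i\<^sub>0 \<le> i\<close>]] by blast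
    then have "C \<subseteq> {v \<in> carrier M. \<delta> v \<in> ?T i}" using C(2) by blast
    then have "?N \<subseteq> {v \<in> carrier M. \<delta> v \<in> ?T i}"
      by (intro M.span_is_subset submodule_preimage[OF M tensor_module[OF M A] coaction_linear]
          tensor_sub_submodule M A N Xs)
    then show ?thesis using sub by (auto simp: is_comodule_for_def)
  qed
  then show ?thesis by blast
qed

lemma is_comodule_for_sum:
  assumes X: "submodule K X A" and N: "is_comodule_for K A M \<delta> X N" and L: "is_comodule_for K A M \<delta> X L"
  shows "is_comodule_for K A M \<delta> X (module.submodule_sum M N L)"
proof -
  interpret M: vectorspace K M by (rule vectorspace)
  note mods = module_M module_A
  have N': "subspace K N M" "\<delta> ` N \<subseteq> tensor_sub K M A N (carrier A)" "\<delta> ` N \<subseteq> tensor_sub K M A N X"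
    and L': "subspace K L M" "\<delta> ` L \<subseteq> tensor_sub K M A L (carrier A)" "\<delta> ` L \<subseteq> tensor_sub K M A L X"
    using N L unfolding is_comodule_for_def is_submodule_def by blast+
  let ?S = "M.submodule_sum N L"
  note S = M.sum_is_subspace[OF N'(1) L'(1)]
  note sN = M.is_module[OF N'(1)] and sL = M.is_module[OF L'(1)] and sS = M.is_module[OF S]
  have NL: "N \<subseteq> ?S" "L \<subseteq> ?S" using M.sum_is_minimal[OF sN sL sS] by simp_all
  have *: "\<delta> ` ?S \<subseteq> tensor_sub K M A ?S Y"
    if Y: "submodule K Y A" and NY: "\<delta> ` N \<subseteq> tensor_sub K M A N Y" "\<delta> ` L \<subseteq> tensor_sub K M A L Y" for Y
  proof -
    let ?P = "{v \<in> carrier M. \<delta> v \<in> tensor_sub K M A ?S Y}"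
    have P: "submodule K ?P M"
      by (rule submodule_preimage[OF mods(1) tensor_module[OF mods] coaction_linear
          tensor_sub_submodule[OF mods sS Y]])
    have "\<delta> ` N \<subseteq> tensor_sub K M A ?S Y" "\<delta> ` L \<subseteq> tensor_sub K M A ?S Y"
      by (rule subset_trans[OF NY(1) tensor_sub_mono[OF mods sN Y sS Y NL(1) subset_refl]],
          rule subset_trans[OF NY(2) tensor_sub_mono[OF mods sL Y sS Y NL(2) subset_refl]])
    then have "N \<subseteq> ?P" "L \<subseteq> ?P"
      using submodule.subset[OF sN] submodule.subset[OF sL] by blast+
    then have "?S \<subseteq> ?P" using M.sum_is_minimal[OF sN sL P] by simp
    then show ?thesis by blast
  qed
  show ?thesis
    unfolding is_comodule_for_def is_submodule_def
    by (intro conjI S *[OF submodule_carrier[OF mods(2)] N'(2) L'(2)] *[OF X N'(3) L'(3)])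
qed

text \<open>
  The \<open>X\<close>-comodules in \<open>M\<close> are directed, by sums, so that their union is a subspace.  A vector of the
  union lies in one of them, say \<open>N\<close>, and its coaction in \<open>N \<otimes> X\<close>, which is contained in \<open>M\<^sub>X \<otimes> X\<close>.
\<close>

lemma is_comodule_for_comodule_part:
  assumes X: "submodule K X A"
  shows "is_comodule_for K A M \<delta> X (comodule_part K A M \<delta> X)"
proof -
  interpret M: vectorspace K M by (rule vectorspace)
  note mods = module_M module_A
  let ?I = "{N. is_comodule_for K A M \<delta> X N}" and ?U = "comodule_part K A M \<delta> X"
  have sub: "submodule K N M" if "N \<in> ?I" for N
    using that by (auto simp: is_comodule_for_def is_submodule_def subspace_def)
  have "is_comodule_for K A M \<delta> X (M.span {})"
  proof -
    have "\<delta> \<zero>\<^bsub>M\<^esub> = \<zero>\<^bsub>tensor K M A\<^esub>"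
      by (rule module_hom_zero[OF mods(1) tensor_module[OF mods] coaction_linear])
    then show ?thesis
      using M.span_is_subspace[of "{}"] X mods submodule_carrier[OF mods(2)]
        submodule.zero_closed[OF tensor_sub_submodule[OF mods M.span_is_submodule[of "{}"]]]
      by (simp add: is_comodule_for_def is_submodule_def M.span_empty)
  qed
  then have ne: "?I \<noteq> {}" by blast
  have dir: "\<exists>S. S \<in> ?I \<and> N \<subseteq> S \<and> L \<subseteq> S" if NL: "N \<in> ?I" "L \<in> ?I" for N L
  proof (intro exI conjI)
    show S: "M.submodule_sum N L \<in> ?I" using is_comodule_for_sum[OF X] NL by simp
    show "N \<subseteq> M.submodule_sum N L" "L \<subseteq> M.submodule_sum N L"
      using M.sum_is_minimal[OF sub[OF NL(1)] sub[OF NL(2)] sub[OF S]] by simp_all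
  qed
  have "submodule K (\<Union>N\<in>?I. N) M"
    by (rule M.nested_union_vs[OF sub dir refl ne])
  then have U: "submodule K ?U M" by (simp add: comodule_part_def)
  have "\<delta> v \<in> tensor_sub K M A ?U X \<inter> tensor_sub K M A ?U (carrier A)" if v: "v \<in> ?U" for v
  proof -
    obtain N where N: "N \<in> ?I" "v \<in> N" using v by (auto simp: comodule_part_def)
    then have "N \<subseteq> ?U" by (auto simp: comodule_part_def)
    then show ?thesis
      using N tensor_sub_mono[OF mods sub[OF N(1)] X U X]
        tensor_sub_mono[OF mods sub[OF N(1)] _ U, of "carrier A" "carrier A"] submodule_carrier[OF mods(2)]
      by (auto simp: is_comodule_for_def is_submodule_def)
  qed
  then show ?thesis using U vectorspace by (auto simp: is_comodule_for_def is_submodule_def subspace_def)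
qed

lemma comodule_part_mono:
  assumes "submodule K X A" "submodule K Y A" "X \<subseteq> Y"
  shows "comodule_part K A M \<delta> X \<subseteq> comodule_part K A M \<delta> Y"
proof -
  have "is_comodule_for K A M \<delta> Y N" if "is_comodule_for K A M \<delta> X N" for N
    using that tensor_sub_mono[OF module_M module_A _ assms(1) _ assms(2) subset_refl assms(3), of N]
    by (auto simp: is_comodule_for_def is_submodule_def subspace_def)
  then show ?thesis by (auto simp: comodule_part_def)
qed

lemma comodule_part_exhaust:
  assumes X: "ascending_converging K A X"
  shows "(\<Union>i. comodule_part K A M \<delta> (X i)) = carrier M"
proof
  show "(\<Union>i. comodule_part K A M \<delta> (X i)) \<subseteq> carrier M"
    by (auto simp: comodule_part_def is_comodule_for_def is_submodule_def subspace_def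
        dest!: submodule.subset)
  show "carrier M \<subseteq> (\<Union>i. comodule_part K A M \<delta> (X i))"
  proof
    fix m assume "m \<in> carrier M"
    then obtain C where C: "finite C" "C \<subseteq> carrier M" "m \<in> module.span K M C"
      "is_submodule K A M \<delta> (module.span K M C)" by (rule locally_finite)
    then obtain i where "is_comodule_for K A M \<delta> (X i) (module.span K M C)"
      using finite_span_eventually_comodule[OF X C(1,2,4)] by blast
    then show "m \<in> (\<Union>i. comodule_part K A M \<delta> (X i))" using C(3) by (auto simp: comodule_part_def)
  qed
qed

end

text \<open>
  The image of an \<open>X\<close>-comodule \<open>L \<subseteq> M\<close> under a morphism \<open>f\<close> is again one, as
  \<open>\<eta> (f l) = (f \<otimes> id) (\<delta> l) \<in> f(L) \<otimes> X\<close>.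
\<close>

lemma comodule_part_functorial:
  assumes M: "group_scheme_module K A \<Delta> \<epsilon> S M \<delta>" and N: "group_scheme_module K A \<Delta> \<epsilon> S N \<eta>"
    and f: "module_morphism K A M \<delta> N \<eta> f" and X: "submodule K X A"
  shows "f ` comodule_part K A M \<delta> X \<subseteq> comodule_part K A N \<eta> X"
proof -
  interpret M: group_scheme_module K A \<Delta> \<epsilon> S M \<delta> by fact
  interpret N: group_scheme_module K A \<Delta> \<epsilon> S N \<eta> by fact
  note mods = M.module_M M.module_A N.module_M M.module_A
  have fh: "f \<in> module_hom K M N"
    and f\<delta>: "\<And>m. m \<in> carrier M \<Longrightarrow> \<eta> (f m) = tensor_map K N A f (\<lambda>a. a) (\<delta> m)"
    using f by (auto simp: module_morphism_def)
  have "is_comodule_for K A N \<eta> X (f ` L)" if L: "is_comodule_for K A M \<delta> X L" for L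
  proof -
    have sL: "submodule K L M" using L by (auto simp: is_comodule_for_def is_submodule_def subspace_def)
    note sfL = submodule_image[OF mods(1,3) fh sL]
    have "\<eta> ` f ` L \<subseteq> tensor_sub K N A (f ` L) Y"
      if Y: "submodule K Y A" "\<delta> ` L \<subseteq> tensor_sub K M A L Y" for Y
    proof -
      have "\<eta> (f l) \<in> tensor_sub K N A (f ` L) Y" if l: "l \<in> L" for l
      proof -
        have "l \<in> carrier M" using l submodule.subset[OF sL] by blast
        moreover have "tensor_map K N A f (\<lambda>a. a) (\<delta> l) \<in> tensor_sub K N A (f ` L) Y"
          using l Y(2) by (intro tensor_map_tensor_sub[OF mods(1,2) sL Y(1) mods(3,4) sfL Y(1) fh
                identity_module_hom[OF mods(2)]]) auto
        ultimately show ?thesis by (simp add: f\<delta>)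
      qed
      then show ?thesis by blast
    qed
    then show ?thesis
      using L X sfL N.vectorspace submodule_carrier[OF mods(2)]
      by (simp add: is_comodule_for_def is_submodule_def subspace_def)
  qed
  then show ?thesis by (auto simp: comodule_part_def)
qed

theorem proposition2p5:
  fixes K :: "'k ring" and A :: "('k, 'a) module"
    and \<Delta> :: "'a \<Rightarrow> ('a \<times> 'a \<Rightarrow> 'k) set" and \<epsilon> :: "'a \<Rightarrow> 'k" and S :: "'a \<Rightarrow> 'a"
    and p :: nat and X :: "nat \<Rightarrow> 'a set"
  assumes "finite_type_group_scheme K A \<Delta> \<epsilon> S"
    and "characteristic K = p" and "p > 0"
    and "ascending_converging K A X"
  shows "(\<forall>(M :: ('k, 'm) module) \<delta>.
            group_scheme_module K A \<Delta> \<epsilon> S M \<delta> \<longrightarrow> vectorspace.fin_dim K M \<longrightarrow>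
            (\<exists>i\<^sub>0. \<forall>i\<ge>i\<^sub>0. is_comodule_for K A M \<delta> (X i) (carrier M)))
       \<and> (\<forall>(M :: ('k, 'm) module) \<delta>.
            group_scheme_module K A \<Delta> \<epsilon> S M \<delta> \<longrightarrow>
            (\<forall>i. is_submodule K A M \<delta> (comodule_part K A M \<delta> (X i))) \<and>
            (\<forall>i. comodule_part K A M \<delta> (X i) \<subseteq> comodule_part K A M \<delta> (X (Suc i))) \<and>
            (\<Union>i. comodule_part K A M \<delta> (X i)) = carrier M \<and>
            (\<forall>i. is_comodule_for K A M \<delta> (X i) (comodule_part K A M \<delta> (X i))))
       \<and> (\<forall>(M :: ('k, 'm) module) \<delta> (N :: ('k, 'n) module) \<eta> f.
            group_scheme_module K A \<Delta> \<epsilon> S M \<delta> \<longrightarrow> group_scheme_module K A \<Delta> \<epsilon> S N \<eta> \<longrightarrow>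
            module_morphism K A M \<delta> N \<eta> f \<longrightarrow>
            (\<forall>i. f ` comodule_part K A M \<delta> (X i) \<subseteq> comodule_part K A N \<eta> (X i)))"
proof (intro conjI allI impI)
  have X: "submodule K (X i) A" "X i \<subseteq> X (Suc i)" for i
    using assms(4) by (auto simp: ascending_converging_def subspace_def)
  fix M :: "('k, 'm) module" and \<delta>
  assume M: "group_scheme_module K A \<Delta> \<epsilon> S M \<delta>"
  interpret group_scheme_module K A \<Delta> \<epsilon> S M \<delta> by (rule M)
  show "\<exists>i\<^sub>0. \<forall>i\<ge>i\<^sub>0. is_comodule_for K A M \<delta> (X i) (carrier M)" if "vectorspace.fin_dim K M"
  proof -
    interpret vectorspace K M by (rule vectorspace)
    from that obtain C where C: "finite C" "C \<subseteq> carrier M" "span C = carrier M"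
      unfolding fin_dim_def by blast
    then show ?thesis
      using finite_span_eventually_comodule[OF assms(4) C(1,2)] is_submodule_carrier by simp
  qed
  show "(\<Union>i. comodule_part K A M \<delta> (X i)) = carrier M" by (rule comodule_part_exhaust[OF assms(4)])
  fix i
  show part: "is_comodule_for K A M \<delta> (X i) (comodule_part K A M \<delta> (X i))"
    by (rule is_comodule_for_comodule_part[OF X(1)])
  show "is_submodule K A M \<delta> (comodule_part K A M \<delta> (X i))"
    using part by (simp add: is_comodule_for_def)
  show "comodule_part K A M \<delta> (X i) \<subseteq> comodule_part K A M \<delta> (X (Suc i))"
    by (rule comodule_part_mono[OF X(1,1,2)])
next
  fix M :: "('k, 'm) module" and \<delta> and N :: "('k, 'n) module" and \<eta> f i
  assume "group_scheme_module K A \<Delta> \<epsilon> S M \<delta>" "group_scheme_module K A \<Delta> \<epsilon> S N \<eta>"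
    "module_morphism K A M \<delta> N \<eta> f"
  moreover have "submodule K (X i) A" using assms(4) by (auto simp: ascending_converging_def subspace_def)
  ultimately show "f ` comodule_part K A M \<delta> (X i) \<subseteq> comodule_part K A N \<eta> (X i)"
    by (rule comodule_part_functorial)
qed

end
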